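(* Let $\Gamma$ be the Coxeter graph. Then $\Gamma$ is a strongly fastened $\{C_7\}_{P_3}$-UH graph with respect to the sequence $P_3, P_2$. That is, $\Gamma$ is a $1$-fastened $\{C_7\}_{P_3}$-UH graph and a $3$-fastened $\{C_7\}_{P_2}$-UH graph. In particular, $\Gamma$ is a $\{C_7\}_{P_3}$-UH graph, and $\Gamma$ has exactly $6n/g = 24$ cycles of length $g=7$, where $n=28$ is its order and $g=7$ its girth.
   Context: The Coxeter graph $\Gamma$ is the cubic graph on $28$ vertices $u_x, v_x, t_x, z_x$ ($x\in\mathbb{Z}_7$) with the following edges. The three $7$-cycles $(u_1u_2u_3u_4u_5u_6u_0)$, $(v_4v_6v_1v_3v_5v_0v_2)$, $(t_3t_6t_2t_5t_1t_4t_0)$, where consecutive vertices are adjacent and the last vertex is adjacent to the first. In addition, for each $x\in\mathbb{Z}_7$, the vertex $z_x$ is adjacent to $u_x$, $v_x$ and $t_x$. It has girth $7$. $P_k$ denotes the path with $k$ vertices and $C_7$ the $7$-cycle. $P_2 = K_2$ is a single edge. For a graph $H$, a graph $G$ is $H$-ultrahomogeneous ($H$-UH) if every isomorphism between two induced subgraphs of $G$ isomorphic to $H$ extends to an automorphism of $G$. Let $M$ be a subgraph of $H$, and let $\ell\ge 1$. A graph $G$ is an $\ell$-fastened $\{H\}_M$-UH graph if all of the following hold: - $G$ is both $M$-UH and $H$-UH; - for every copy $H_0$ of $H$ in $G$ and every copy $M_0$ of $M$ contained in $H_0$, there exist exactly $\ell$ copies $H_1,\dots,H_\ell$ of $H$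 in $G$, all different from $H_0$, with $H_i\cap H_0\supseteq M_0$ for $i=1,\dots,\ell$; - at least one of these, $H_1$, satisfies $H_1\cap H_0=M_0$ (equal vertex sets and equal edge sets). A $1$-fastened $\{H\}_M$-UH graph is simply called an $\{H\}_M$-UH graph (tightly fastened). $G$ is strongly fastened (SF) $\{H\}_M$-UH if there is a sequence of connected subgraphs $M=M_1,M_2,\dots,M_t\cong K_2$ such that: - each $M_{i+1}$ is obtained from $M_i$ by deleting a vertex; - $G$ is a $(2^i-1)$-fastened $\{H\}_{M_i}$-UH graph for $i=1,\dots,t$. *)

theory Defs
  imports Complex_Main "HOL-Library.Numeral_Type"
begin

record 'a ugraph =
  verts :: "'a set"
  edges :: "'a set set"

definition simple_graph :: "'a ugraph \<Rightarrow> bool" where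
  "simple_graph G \<longleftrightarrow>
     (\<forall>e\<in>edges G. \<exists>x\<in>verts G. \<exists>y\<in>verts G. x \<noteq> y \<and> e = {x, y})"

definition subgraph :: "'a ugraph \<Rightarrow> 'a ugraph \<Rightarrow> bool" where
  "subgraph H G \<longleftrightarrow> simple_graph H \<and> verts H \<subseteq> verts G \<and> edges H \<subseteq> edges G"

definition induced_subgraph :: "'a ugraph \<Rightarrow> 'a ugraph \<Rightarrow> bool" where
  "induced_subgraph H G \<longleftrightarrow> subgraph H G \<and> edges H = {e \<in> edges G. e \<subseteq> verts H}"

definition graph_inter :: "'a ugraph \<Rightarrow> 'a ugraph \<Rightarrow> 'a ugraph" where
  "graph_inter G H = \<lparr>verts = verts G \<inter> verts H, edges = edges G \<inter> edges H\<rparr>"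

definition delete_vertex :: "'a ugraph \<Rightarrow> 'a \<Rightarrow> 'a ugraph" where
  "delete_vertex G v = \<lparr>verts = verts G - {v}, edges = {e \<in> edges G. v \<notin> e}\<rparr>"

definition connected_graph :: "'a ugraph \<Rightarrow> bool" where
  "connected_graph G \<longleftrightarrow> verts G \<noteq> {} \<and>
     (\<forall>x\<in>verts G. \<forall>y\<in>verts G. (x, y) \<in> {(a, b). {a, b} \<in> edges G}\<^sup>*)"

(* Maps are total in HOL; only the values on verts G are constrained. *)
definition isomorphism :: "('a \<Rightarrow> 'b) \<Rightarrow> 'a ugraph \<Rightarrow> 'b ugraph \<Rightarrow> bool" where
  "isomorphism f G H \<longleftrightarrow> bij_betw f (verts G) (verts H) \<and>
     (\<forall>x\<in>verts G. \<forall>y\<in>verts G. {x, y} \<in> edges G \<longleftrightarrow> {f x, f y} \<in> edges H)"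

definition isomorphic :: "'a ugraph \<Rightarrow> 'b ugraph \<Rightarrow> bool" where
  "isomorphic G H \<longleftrightarrow> (\<exists>f. isomorphism f G H)"

definition automorphism :: "('a \<Rightarrow> 'a) \<Rightarrow> 'a ugraph \<Rightarrow> bool" where
  "automorphism f G \<longleftrightarrow> isomorphism f G G"

definition path_graph :: "nat \<Rightarrow> nat ugraph" where
  "path_graph k = \<lparr>verts = {..<k}, edges = {{i, i + 1} | i. i + 1 < k}\<rparr>"

(* A cycle only for n \<ge> 3. *)
definition cycle_graph :: "nat \<Rightarrow> nat ugraph" where
  "cycle_graph n = \<lparr>verts = {..<n}, edges = {{i, (i + 1) mod n} | i. i < n}\<rparr>"

definition complete_graph :: "nat \<Rightarrow> nat ugraph" where
  "complete_graph n = \<lparr>verts = {..<n}, edges = {{i, j} | i j. i < n \<and> j < n \<and> i \<noteq> j}\<rparr>"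

(* Copies are arbitrary subgraphs, not necessarily induced ones. *)
definition copies :: "'b ugraph \<Rightarrow> 'a ugraph \<Rightarrow> 'a ugraph set" where
  "copies H G = {K. subgraph K G \<and> isomorphic K H}"

(* Only meaningful for graphs that contain a cycle. *)
definition girth :: "'a ugraph \<Rightarrow> nat" where
  "girth G = (LEAST n. 3 \<le> n \<and> copies (cycle_graph n) G \<noteq> {})"

definition ultrahomogeneous :: "'b ugraph \<Rightarrow> 'a ugraph \<Rightarrow> bool" where
  "ultrahomogeneous H G \<longleftrightarrow>
     (\<forall>A B f. induced_subgraph A G \<and> induced_subgraph B G \<and>
        isomorphic A H \<and> isomorphic B H \<and> isomorphism f A B \<longrightarrow>
        (\<exists>g. automorphism g G \<and> (\<forall>x\<in>verts A. g x = f x)))"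

definition other_copies :: "'b ugraph \<Rightarrow> 'a ugraph \<Rightarrow> 'a ugraph \<Rightarrow> 'a ugraph \<Rightarrow> 'a ugraph set" where
  "other_copies H G H0 M0 =
     {K \<in> copies H G. K \<noteq> H0 \<and> subgraph M0 (graph_inter K H0)}"

(* Since l \<ge> 1, the cardinality condition also says that the set of other copies is finite. *)
definition fastened_UH :: "nat \<Rightarrow> 'b ugraph \<Rightarrow> 'b ugraph \<Rightarrow> 'a ugraph \<Rightarrow> bool" where
  "fastened_UH l H M G \<longleftrightarrow>
     subgraph M H \<and> 1 \<le> l \<and> ultrahomogeneous M G \<and> ultrahomogeneous H G \<and>
     (\<forall>H0\<in>copies H G. \<forall>M0\<in>copies M H0.
        card (other_copies H G H0 M0) = l \<and>
        (\<exists>H1\<in>other_copies H G H0 M0. graph_inter H1 H0 = M0))"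

definition tightly_fastened_UH :: "'b ugraph \<Rightarrow> 'b ugraph \<Rightarrow> 'a ugraph \<Rightarrow> bool" where
  "tightly_fastened_UH H M G \<longleftrightarrow> fastened_UH 1 H M G"

(* The list Ms is indexed from 0, so Ms ! i is the subgraph usually written M_(i+1). *)
definition strongly_fastened_UH_wrt :: "'b ugraph list \<Rightarrow> 'b ugraph \<Rightarrow> 'a ugraph \<Rightarrow> bool" where
  "strongly_fastened_UH_wrt Ms H G \<longleftrightarrow>
     Ms \<noteq> [] \<and> isomorphic (last Ms) (complete_graph 2) \<and>
     (\<forall>i<length Ms. connected_graph (Ms ! i) \<and> subgraph (Ms ! i) H) \<and>
     (\<forall>i. i + 1 < length Ms \<longrightarrow>
        (\<exists>v\<in>verts (Ms ! i). Ms ! (i + 1) = delete_vertex (Ms ! i) v)) \<and>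
     (\<forall>i<length Ms. fastened_UH (2 ^ (i + 1) - 1) H (Ms ! i) G)"

definition strongly_fastened_UH :: "'b ugraph \<Rightarrow> 'b ugraph \<Rightarrow> 'a ugraph \<Rightarrow> bool" where
  "strongly_fastened_UH H M G \<longleftrightarrow>
     (\<exists>Ms. Ms \<noteq> [] \<and> hd Ms = M \<and> strongly_fastened_UH_wrt Ms H G)"

(* The type 7 is the ring of integers modulo 7. *)
datatype coxeter_vertex = U "7" | V "7" | T "7" | Z "7"

definition closed_walk_edges :: "'a list \<Rightarrow> 'a set set" where
  "closed_walk_edges xs = {{xs ! i, xs ! ((i + 1) mod length xs)} | i. i < length xs}"

definition coxeter_graph :: "coxeter_vertex ugraph" where
  "coxeter_graph =
     \<lparr>verts = UNIV,
      edges = closed_walk_edges [U 1, U 2, U 3, U 4, U 5, U 6, U 0]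
            \<union> closed_walk_edges [V 4, V 6, V 1, V 3, V 5, V 0, V 2]
            \<union> closed_walk_edges [T 3, T 6, T 2, T 5, T 1, T 4, T 0]
            \<union> (\<Union>x. {{Z x, U x}, {Z x, V x}, {Z x, T x}})\<rparr>"

end

theory Submission
  imports Defs
begin

text \<open>
  Translations, negation and multiplication by 2 on the indices, together with one further
  involution fixing \<open>z\<^sub>0\<close>, \<open>u\<^sub>0\<close>, \<open>u\<^sub>1\<close> and exchanging \<open>u\<^sub>2\<close> with \<open>z\<^sub>1\<close>, make the automorphism group
  transitive on 3-arcs. Through the 3-arc \<open>z\<^sub>0 u\<^sub>0 u\<^sub>1 u\<^sub>2\<close> there is exactly one heptagon, so
  the same holds for every 3-arc; hence an isomorphism between heptagons is determined by a 3-arc and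
  is induced by an automorphism. All remaining claims can then be moved to the heptagons through
  the edge \<open>z\<^sub>0 u\<^sub>0\<close>, of which there are four. Finally, each of the 42 edges lies on 4 heptagons
  with 7 edges each, which gives 42 * 4 / 7 = 24 heptagons.
\<close>

section \<open>Embeddings and copies\<close>

text \<open>In a cubic graph a non-backtracking walk has two continuations at each step. As one
  heptagon passes through each 3-arc, there are two through each \<open>P_3\<close> and four through
  each edge. Leaving out the given heptagon gives 1 and 3, which explains the values 2^i - 1. As a
  cross-check, the 28 * 3 * 2 * 2 = 336 3-arcs match 24 heptagons with 14 directed 3-arcs each.

  The obstacle is that copies are graphs, whereas all arguments run along sequences of vertices, and
  a heptagon has 14 parametrisations as a cycle. Copies are therefore handled through embeddings,
  and the dihedral symmetries serve to choose the parametrisation that begins with a prescribed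
  path.\<close>

definition map_graph :: "('a \<Rightarrow> 'b) \<Rightarrow> 'a ugraph \<Rightarrow> 'b ugraph" where
  "map_graph f G = \<lparr>verts = f ` verts G, edges = (`) f ` edges G\<rparr>"

definition embedding :: "('b \<Rightarrow> 'a) \<Rightarrow> 'b ugraph \<Rightarrow> 'a ugraph \<Rightarrow> bool" where
  "embedding c H G \<longleftrightarrow> inj_on c (verts H) \<and> subgraph (map_graph c H) G"

lemma verts_map_graph [simp]: "verts (map_graph f G) = f ` verts G"
  and edges_map_graph [simp]: "edges (map_graph f G) = (`) f ` edges G"
  by (simp_all add: map_graph_def)

lemma map_graph_comp: "map_graph f (map_graph g G) = map_graph (f \<circ> g) G"
  by (simp add: map_graph_def image_image)

lemma simple_graph_edge_subset: "simple_graph G \<Longrightarrow> e \<in> edges G \<Longrightarrow> e \<subseteq> verts G"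
  unfolding simple_graph_def by fastforce

lemma map_graph_cong:
  assumes "simple_graph G" "\<And>x. x \<in> verts G \<Longrightarrow> f x = g x"
  shows "map_graph f G = map_graph g G"
proof -
  have "f ` e = g ` e" if "e \<in> edges G" for e
    using simple_graph_edge_subset[OF assms(1) that] assms(2) by (intro image_cong) auto
  then show ?thesis
    using assms(2) by (simp add: map_graph_def cong: image_cong)
qed

lemma simple_map_graph:
  assumes "simple_graph G" "inj_on f (verts G)"
  shows "simple_graph (map_graph f G)"
  unfolding simple_graph_def
proof
  fix e assume "e \<in> edges (map_graph f G)"
  then obtain e' where "e' \<in> edges G" "e = f ` e'"
    by auto
  moreover then obtain x y where "x \<in> verts G" "y \<in> verts G" "x \<noteq> y" "e' = {x, y}"
    using assms(1) unfolding simple_graph_def by blast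
  ultimately have "f x \<in> verts (map_graph f G)" "f y \<in> verts (map_graph f G)" "f x \<noteq> f y"
      "e = {f x, f y}"
    using assms(2) by (auto simp: inj_on_def)
  then show "\<exists>x\<in>verts (map_graph f G). \<exists>y\<in>verts (map_graph f G). x \<noteq> y \<and> e = {x, y}"
    by blast
qed

text \<open>\<open>isomorphism\<close> only compares sets of the form \<open>{x, y}\<close>.
  Simplicity of both graphs ensures that every edge has this form, so that the map determines the
  whole edge set of the target.\<close>

lemma isomorphism_eq_map_graph:
  assumes "simple_graph A" "simple_graph B" "isomorphism f A B"
  shows "B = map_graph f A"
proof -
  have vB: "verts B = f ` verts A"
    and iff: "\<And>x y. x \<in> verts A \<Longrightarrow> y \<in> verts A \<Longrightarrow> {x, y} \<in> edges A \<longleftrightarrow> {f x, f y} \<in> edges B"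
    using assms(3) by (auto simp: isomorphism_def bij_betw_def)
  have "edges B = (`) f ` edges A"
  proof (intro equalityI subsetI)
    fix e assume e: "e \<in> edges B"
    then obtain x' y' where "x' \<in> verts B" "y' \<in> verts B" "e = {x', y'}"
      using assms(2) unfolding simple_graph_def by blast
    then obtain x y where xy: "x \<in> verts A" "y \<in> verts A" and e_eq: "e = f ` {x, y}"
      unfolding vB by blast
    have "{x, y} \<in> edges A"
      unfolding iff[OF xy] using e e_eq by simp
    with e_eq show "e \<in> (`) f ` edges A"
      by (rule rev_image_eqI[rotated])
  next
    fix e assume "e \<in> (`) f ` edges A"
    then obtain e' where e': "e' \<in> edges A" "e = f ` e'"
      by blast
    then obtain x y where xy: "x \<in> verts A" "y \<in> verts A" and "e' = {x, y}"
      using assms(1) unfolding simple_graph_def by blast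
    then show "e \<in> edges B"
      using e' iff[OF xy] by simp
  qed
  with vB show ?thesis
    by (simp add: map_graph_def)
qed

lemma isomorphism_map_graph:
  assumes "simple_graph H" "inj_on c (verts H)"
  shows "isomorphism c H (map_graph c H)"
  unfolding isomorphism_def
proof (intro conjI ballI)
  fix x y assume xy: "x \<in> verts H" "y \<in> verts H"
  show "{x, y} \<in> edges H \<longleftrightarrow> {c x, c y} \<in> edges (map_graph c H)"
  proof
    assume "{c x, c y} \<in> edges (map_graph c H)"
    then obtain e where e: "e \<in> edges H" "c ` e = c ` {x, y}"
      by auto
    have "e \<subseteq> verts H" "{x, y} \<subseteq> verts H"
      using simple_graph_edge_subset[OF assms(1) e(1)] xy by simp_all
    then have "e = {x, y}"
      using e(2) inj_on_image_eq_iff[OF assms(2), of e "{x, y}"] by blast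
    with e show "{x, y} \<in> edges H"
      by simp
  next
    assume "{x, y} \<in> edges H"
    then have "c ` {x, y} \<in> edges (map_graph c H)"
      unfolding edges_map_graph by (rule imageI)
    then show "{c x, c y} \<in> edges (map_graph c H)"
      by simp
  qed
qed (use assms(2) in \<open>auto simp: bij_betw_def\<close>)

lemma isomorphism_inv_into:
  assumes "isomorphism f A B"
  shows "isomorphism (inv_into (verts A) f) B A"
proof -
  have bij: "bij_betw f (verts A) (verts B)"
    using assms by (simp add: isomorphism_def)
  let ?g = "inv_into (verts A) f"
  have g: "f (?g x) = x" "?g x \<in> verts A" if "x \<in> verts B" for x
    using that bij by (simp_all add: bij_betw_def f_inv_into_f inv_into_into)
  have "{x, y} \<in> edges B \<longleftrightarrow> {?g x, ?g y} \<in> edges A" if "x \<in> verts B" "y \<in> verts B" for x y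
  proof -
    have "{?g x, ?g y} \<in> edges A \<longleftrightarrow> {f (?g x), f (?g y)} \<in> edges B"
      using assms g(2) that unfolding isomorphism_def by blast
    then show ?thesis
      by (simp only: g(1) that)
  qed
  then show ?thesis
    using bij_betw_inv_into[OF bij] unfolding isomorphism_def by blast
qed

lemma isomorphic_imp_map_graph:
  assumes "simple_graph H" "simple_graph K" "isomorphic K H"
  obtains c where "inj_on c (verts H)" "K = map_graph c H"
proof -
  obtain f where "isomorphism f K H"
    using assms(3) by (auto simp: isomorphic_def)
  then have *: "isomorphism (inv_into (verts K) f) H K"
    by (rule isomorphism_inv_into)
  then have "inj_on (inv_into (verts K) f) (verts H)"
    by (auto simp: isomorphism_def bij_betw_def)
  with isomorphism_eq_map_graph[OF assms(1,2) *] show thesis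
    using that by blast
qed

text \<open>The bridge from copies as graphs to vertex sequences: from here on a copy is given by
  some parametrisation, which need not be unique.\<close>

lemma copies_eq:
  assumes "simple_graph H"
  shows "copies H G = {map_graph c H | c. embedding c H G}"
proof (intro equalityI subsetI)
  fix K assume "K \<in> copies H G"
  then have K: "subgraph K G" "isomorphic K H"
    by (auto simp: copies_def)
  then obtain c where "inj_on c (verts H)" "K = map_graph c H"
    using isomorphic_imp_map_graph[OF assms] by (metis subgraph_def)
  with K show "K \<in> {map_graph c H | c. embedding c H G}"
    by (auto simp: embedding_def)
next
  fix K assume "K \<in> {map_graph c H | c. embedding c H G}"
  then obtain c where "K = map_graph c H" "embedding c H G"
    by auto
  then show "K \<in> copies H G"
    using isomorphism_inv_into[OF isomorphism_map_graph[OF assms]]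
    by (auto simp: copies_def embedding_def isomorphic_def)
qed

lemma embedding_iff:
  assumes "simple_graph H"
  shows "embedding c H G \<longleftrightarrow>
    inj_on c (verts H) \<and> c ` verts H \<subseteq> verts G \<and> (\<forall>e\<in>edges H. c ` e \<in> edges G)"
  using simple_map_graph[OF assms] by (auto simp: embedding_def subgraph_def)

text \<open>If \<open>c\<close> parametrises \<open>A\<close> and \<open>f\<close> maps
  \<open>A\<close> isomorphically to \<open>B\<close>, then \<open>f \<circ> c\<close> parametrises
  \<open>B\<close>. An automorphism that matches the two parametrisations thus extends
  \<open>f\<close>.\<close>

lemma ultrahomogeneousI:
  assumes "simple_graph H"
    and ext: "\<And>c c'. embedding c H G \<Longrightarrow> embedding c' H G \<Longrightarrow>
      \<exists>g. automorphism g G \<and> (\<forall>x\<in>verts H. g (c x) = c' x)"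
  shows "ultrahomogeneous H G"
  unfolding ultrahomogeneous_def
proof (intro allI impI, elim conjE)
  fix A B f
  assume "induced_subgraph A G" "induced_subgraph B G" "isomorphic A H" and f: "isomorphism f A B"
  then have A: "subgraph A G" "simple_graph A" and B: "subgraph B G" "simple_graph B"
    by (auto simp: induced_subgraph_def subgraph_def)
  obtain c where c: "inj_on c (verts H)" "A = map_graph c H"
    using isomorphic_imp_map_graph[OF assms(1) A(2) \<open>isomorphic A H\<close>] by blast
  have B_eq: "B = map_graph (f \<circ> c) H"
    using isomorphism_eq_map_graph[OF A(2) B(2) f] c by (simp add: map_graph_comp)
  have "inj_on (f \<circ> c) (verts H)"
    using f c by (auto simp: isomorphism_def bij_betw_def intro: comp_inj_on)
  then have "embedding (f \<circ> c) H G" "embedding c H G"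
    using c A B B_eq by (auto simp: embedding_def)
  from ext[OF this(2,1)] show "\<exists>g. automorphism g G \<and> (\<forall>x\<in>verts A. g x = f x)"
    using c by auto
qed

section \<open>Paths and cycles\<close>

lemma simple_cycle_graph:
  assumes "2 \<le> n"
  shows "simple_graph (cycle_graph n)"
  unfolding simple_graph_def
proof
  fix e assume "e \<in> edges (cycle_graph n)"
  then obtain i where i: "i < n" "e = {i, (i + 1) mod n}"
    by (auto simp: cycle_graph_def)
  have "(i + 1) mod n < n"
    using assms by simp
  moreover have "i \<noteq> (i + 1) mod n"
    using assms i(1) by (cases "i + 1 = n") auto
  moreover have "verts (cycle_graph n) = {..<n}"
    by (simp add: cycle_graph_def)
  ultimately show "\<exists>x\<in>verts (cycle_graph n). \<exists>y\<in>verts (cycle_graph n). x \<noteq> y \<and> e = {x, y}"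
    using i by blast
qed

lemma simple_path_graph: "simple_graph (path_graph n)"
  unfolding simple_graph_def
proof
  fix e assume "e \<in> edges (path_graph n)"
  then obtain i where "i < n" "i + 1 < n" "e = {i, i + 1}"
    by (auto simp: path_graph_def)
  moreover have "i \<noteq> i + 1" "verts (path_graph n) = {..<n}"
    by (simp_all add: path_graph_def)
  ultimately show "\<exists>x\<in>verts (path_graph n). \<exists>y\<in>verts (path_graph n). x \<noteq> y \<and> e = {x, y}"
    by blast
qed

lemma path_graph_eq: "path_graph n = \<lparr>verts = {..<n}, edges = (\<lambda>i. {i, i + 1}) ` {..<n - 1}\<rparr>"
  by (auto simp: path_graph_def)

lemma cycle_graph_eq:
  "cycle_graph n = \<lparr>verts = {..<n}, edges = (\<lambda>i. {i, (i + 1) mod n}) ` {..<n}\<rparr>"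
  by (auto simp: cycle_graph_def)

lemma lessThan_7: "{..<7} = {0, 1, 2, 3, 4, 5, 6::nat}" "{..<3} = {0, 1, 2::nat}" "{..<2} = {0, 1::nat}"
  by auto

lemma path_2: "path_graph 2 = \<lparr>verts = {0, 1}, edges = {{0, 1}}\<rparr>"
  by (simp add: path_graph_eq lessThan_7 lessThan_Suc)

lemma path_3: "path_graph 3 = \<lparr>verts = {0, 1, 2}, edges = {{0, 1}, {1, 2}}\<rparr>"
  by (simp add: path_graph_eq lessThan_7) (simp add: numeral_2_eq_2)

lemma cycle_7: "cycle_graph 7 = \<lparr>verts = {0, 1, 2, 3, 4, 5, 6},
    edges = {{0, 1}, {1, 2}, {2, 3}, {3, 4}, {4, 5}, {5, 6}, {6, 0}}\<rparr>"
  by (simp add: cycle_graph_eq lessThan_7) (simp add: numeral_2_eq_2)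

lemma embedding_cycle_iff:
  assumes "2 \<le> n"
  shows "embedding c (cycle_graph n) G \<longleftrightarrow> inj_on c {..<n} \<and> c ` {..<n} \<subseteq> verts G \<and>
    (\<forall>i<n. {c i, c ((i + 1) mod n)} \<in> edges G)"
  unfolding embedding_iff[OF simple_cycle_graph[OF assms]] unfolding cycle_graph_eq
  by (simp only: ugraph.select_convs ball_simps image_insert image_empty) (simp only: Ball_def lessThan_iff)

text \<open>The dihedral symmetries of the heptagon: \<open>k + 6 * i\<close> is \<open>k - i\<close> modulo 7.\<close>

lemma map_graph_dihedral:
  assumes "k < 7" "s = 1 \<or> s = 6"
  shows "map_graph (\<lambda>i. (k + s * i) mod 7) (cycle_graph 7) = cycle_graph 7"
proof -
  have "k \<in> {0, 1, 2, 3, 4, 5, 6}" using assms(1) by auto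
  then show ?thesis
    using assms(2) unfolding cycle_7 map_graph_def by (elim insertE disjE emptyE; simp add: insert_commute) (simp_all add: numeral_2_eq_2) 
qed
lemma inj_on_dihedral:
  assumes "map_graph r (cycle_graph 7) = cycle_graph 7"
  shows "inj_on r {..<7}" "r ` {..<7} = {..<7}"
proof -
  show "r ` {..<7} = {..<7}"
    using arg_cong[OF assms, of verts] by (simp add: cycle_graph_def)
  then show "inj_on r {..<7}"
    by (intro eq_card_imp_inj_on) auto
qed

text \<open>Pulls a path inside a copy of the heptagon back to the standard cycle, where positions
  are numbers and arithmetic modulo 7 applies.\<close>

lemma embedding_lift:
  assumes "simple_graph M" "simple_graph H" "inj_on c (verts H)" "embedding d M (map_graph c H)"
  obtains d' where "embedding d' M H" "\<And>x. x \<in> verts M \<Longrightarrow> d x = c (d' x)"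
proof
  let ?d' = "inv_into (verts H) c \<circ> d"
  have d: "inj_on d (verts M)" "d ` verts M \<subseteq> c ` verts H"
    "\<And>e. e \<in> edges M \<Longrightarrow> d ` e \<in> (`) c ` edges H"
    using assms(4) by (auto simp: embedding_iff[OF assms(1)])
  show eq: "d x = c (?d' x)" if "x \<in> verts M" for x
    using d(2) that by (auto simp: f_inv_into_f)
  have "?d' ` e \<in> edges H" if e: "e \<in> edges M" for e
  proof -
    obtain e' where e': "e' \<in> edges H" "d ` e = c ` e'"
      using d(3)[OF e] by blast
    have "?d' ` e = inv_into (verts H) c ` c ` e'"
      by (simp only: image_comp[symmetric] e'(2))
    also have "\<dots> = e'"
      using inv_into_image_cancel[OF assms(3)] simple_graph_edge_subset[OF assms(2) e'(1)] .
    finally show ?thesis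
      using e' by simp
  qed
  moreover have "?d' ` verts M \<subseteq> verts H"
    using d(2) by (auto intro!: inv_into_into)
  moreover have "inj_on ?d' (verts M)"
    using d(1,2) by (intro comp_inj_on inj_on_inv_into)
  ultimately show "embedding ?d' M H"
    by (simp add: embedding_iff[OF assms(1)])
qed

lemma cycle_7_adjacent:
  assumes "{i, j} \<in> edges (cycle_graph 7)"
  obtains s where "i < 7" "s = 1 \<or> s = 6" "j = (i + s) mod 7"
proof -
  have "i < 7 \<and> (j = (i + 1) mod 7 \<or> j = (i + 6) mod 7)"
    using assms unfolding cycle_7 ugraph.select_convs insert_iff doubleton_eq_iff empty_iff
    by (elim disjE conjE FalseE) simp_all
  then show thesis
    using that by blast
qed

text \<open>A path in the cycle has a starting vertex \<open>d 0\<close> and a direction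
  \<open>s\<close>, and these are exactly the data of a dihedral symmetry. A second step in the
  other direction would lead back to \<open>d 0\<close>.\<close>

lemma path_in_cycle_7:
  assumes "k = 2 \<or> k = 3" "embedding d (path_graph k) (cycle_graph 7)"
  obtains r where "map_graph r (cycle_graph 7) = cycle_graph 7" "\<And>i. i < k \<Longrightarrow> r i = d i"
proof -
  have inj: "inj_on d {..<k}" and edge: "\<And>e. e \<in> edges (path_graph k) \<Longrightarrow> d ` e \<in> edges (cycle_graph 7)"
    using assms(2) unfolding embedding_iff[OF simple_path_graph] by (auto simp: path_graph_eq)
  have "{d 0, d 1} \<in> edges (cycle_graph 7)"
    using edge[of "{0, 1}"] assms(1) by (auto simp: path_2 path_3)
  then obtain s where s: "d 0 < 7" "s = 1 \<or> s = 6" "d 1 = (d 0 + s) mod 7"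
    by (rule cycle_7_adjacent)
  have "d 2 = (d 0 + s * 2) mod 7" if "k = 3"
  proof -
    have ne: "d 2 \<noteq> d 0"
      using inj_onD[OF inj, of 2 0] that by auto
    have "{d 1, d 2} \<in> edges (cycle_graph 7)"
      using edge[of "{1, 2}"] that by (simp add: path_3)
    then obtain s'
      where s': "s' = 1 \<or> s' = 6" "d 2 = (d 1 + s') mod 7"
      by (rule cycle_7_adjacent)
    have "s' = s"
    proof (rule ccontr)
      assume "s' \<noteq> s"
      \<comment> \<open>The directions are 1 and 6, the latter standing for -1 in the natural
        numbers, so two different ones cancel modulo 7.\<close>
      with s(2) s'(1) have "s + s' = 7" by auto
      then have "d 2 = (d 0 + 7) mod 7"
        using s(3) s'(2) by (metis add.assoc mod_add_left_eq)
      with s(1) ne show False by simp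
    qed
    then show ?thesis
      using s'(2) s(3) by (simp add: mod_add_left_eq mult_2_right add.assoc)
  qed
  then have "(d 0 + s * i) mod 7 = d i" if "i < k" for i
  proof -
    have "i = 0 \<or> i = 1 \<or> i = 2 \<and> k = 3"
      using that assms(1) by auto
    then show ?thesis
      using s(1,3) \<open>k = 3 \<Longrightarrow> d 2 = (d 0 + s * 2) mod 7\<close> by auto
  qed
  with map_graph_dihedral[OF s(1,2)] show thesis
    by (rule that)
qed

text \<open>Any path in a copy may be taken as the initial segment of a parametrisation of that
  copy. Hence a pair of a heptagon and a path in it is described by one map.\<close>

lemma copies_cycle_path:
  assumes k: "k = 2 \<or> k = 3" and H0: "H0 \<in> copies (cycle_graph 7) G"
    and d: "embedding d (path_graph k) H0"
  obtains c where "embedding c (cycle_graph 7) G" "H0 = map_graph c (cycle_graph 7)"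
    "\<And>i. i < k \<Longrightarrow> c i = d i"
proof -
  have simple: "simple_graph (cycle_graph 7)"
    by (rule simple_cycle_graph) simp
  obtain c where c: "embedding c (cycle_graph 7) G" "H0 = map_graph c (cycle_graph 7)"
    using H0 by (auto simp: copies_eq[OF simple])
  have inj: "inj_on c (verts (cycle_graph 7))"
    using c by (simp add: embedding_def)
  obtain d' where d': "embedding d' (path_graph k) (cycle_graph 7)"
      "\<And>x. x \<in> verts (path_graph k) \<Longrightarrow> d x = c (d' x)"
    using embedding_lift[OF simple_path_graph simple inj] d c(2) by metis
  obtain r where r: "map_graph r (cycle_graph 7) = cycle_graph 7" "\<And>i. i < k \<Longrightarrow> r i = d' i"
    using path_in_cycle_7[OF k d'(1)] by metis
  show thesis
  proof
    have eq: "map_graph (c \<circ> r) (cycle_graph 7) = map_graph c (cycle_graph 7)"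
      using r(1) by (metis map_graph_comp)
    then show "H0 = map_graph (c \<circ> r) (cycle_graph 7)"
      using c by simp
    have "inj_on (c \<circ> r) (verts (cycle_graph 7))"
      using inj inj_on_dihedral[OF r(1)] by (auto simp: cycle_graph_def intro: comp_inj_on)
    then show "embedding (c \<circ> r) (cycle_graph 7) G"
      using c(1) by (simp add: embedding_def eq)
    show "(c \<circ> r) i = d i" if "i < k" for i
      using d'(2)[of i] r(2)[OF that] that by (simp add: path_graph_def)
  qed
qed

section \<open>The Coxeter graph\<close>

abbreviation (input) "\<Gamma> \<equiv> coxeter_graph"

fun nbrs :: "coxeter_vertex \<Rightarrow> coxeter_vertex set" where
  "nbrs (U x) = {U (x + 1), U (x - 1), Z x}"
| "nbrs (V x) = {V (x + 2), V (x - 2), Z x}"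
| "nbrs (T x) = {T (x + 3), T (x - 3), Z x}"
| "nbrs (Z x) = {U x, V x, T x}"

lemma reduce_7: "(7::7) = 0" "(8::7) = 1" "(9::7) = 2"
  by simp_all

lemma UNIV_7: "(UNIV :: 7 set) = {0, 1, 2, 3, 4, 5, 6}"
proof -
  have "card {0, 1, 2, 3, 4, 5, 6 :: 7} = CARD(7)"
    by simp
  then show ?thesis
    by (metis card_subset_eq finite subset_UNIV)
qed

lemma exhaust_7: "x \<in> {0, 1, 2, 3, 4, 5, 6}" for x :: 7
  using UNIV_7 by blast

lemma closed_walk_edges_eq:
  "closed_walk_edges xs = (\<lambda>i. {xs ! i, xs ! ((i + 1) mod length xs)}) ` {..<length xs}"
  by (auto simp: closed_walk_edges_def)

text \<open>The three listed cycles are arithmetic progressions in the integers modulo 7, with steps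
  1, 2 and 3. This makes the translations visible as symmetries.\<close>

lemma closed_walk_edges_coxeter:
  "closed_walk_edges [U 1, U 2, U 3, U 4, U 5, U 6, U 0] = (\<lambda>x. {U x, U (x + 1)}) ` UNIV"
  "closed_walk_edges [V 4, V 6, V 1, V 3, V 5, V 0, V 2] = (\<lambda>x. {V x, V (x + 2)}) ` UNIV"
  "closed_walk_edges [T 3, T 6, T 2, T 5, T 1, T 4, T 0] = (\<lambda>x. {T x, T (x + 3)}) ` UNIV"
  unfolding closed_walk_edges_eq UNIV_7
  by (simp_all add: lessThan_nat_numeral lessThan_Suc numeral_2_eq_2 reduce_7 insert_commute)

lemma doubleton_step_iff:
  fixes x y k :: "'a :: ab_group_add"
  assumes "inj f"
  shows "{f x, f y} \<in> range (\<lambda>z. {f z, f (z + k)}) \<longleftrightarrow> y = x + k \<or> y = x - k"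
proof -
  have "{f x, f y} \<in> range (\<lambda>z. {f z, f (z + k)}) \<longleftrightarrow>
      (\<exists>z. x = z \<and> y = z + k \<or> x = z + k \<and> y = z)"
    by (simp add: image_iff doubleton_eq_iff inj_eq[OF assms])
  also have "\<dots> \<longleftrightarrow> y = x + k \<or> x = y + k"
    by blast
  also have "\<dots> \<longleftrightarrow> y = x + k \<or> y = x - k"
    by (simp add: eq_diff_eq eq_commute)
  finally show ?thesis .
qed

lemma edges_coxeter: "{x, y} \<in> edges \<Gamma> \<longleftrightarrow> y \<in> nbrs x"
proof -
  have inj: "inj U" "inj V" "inj T"
    by (simp_all add: inj_def)
  show ?thesis
    unfolding coxeter_graph_def closed_walk_edges_coxeter ugraph.select_convs Un_iff
    by (cases x; cases y; simp add: doubleton_step_iff inj)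
      (simp_all add: image_iff doubleton_eq_iff)
qed

lemma simple_coxeter: "simple_graph \<Gamma>"
  unfolding simple_graph_def
proof
  fix e assume "e \<in> edges \<Gamma>"
  then obtain x y where "e = {x, y}" "y \<in> nbrs x"
    using edges_coxeter unfolding coxeter_graph_def closed_walk_edges_coxeter by auto
  moreover have "y \<noteq> x" if "y \<in> nbrs x" for x y
    using that by (cases x) auto
  ultimately show "\<exists>x\<in>verts \<Gamma>. \<exists>y\<in>verts \<Gamma>. x \<noteq> y \<and> e = {x, y}"
    by (metis (mono_tags) UNIV_I coxeter_graph_def ugraph.select_convs(1))
qed

lemma verts_coxeter [simp]: "verts \<Gamma> = UNIV"
  by (simp add: coxeter_graph_def)

lemma nbrs_sym: "y \<in> nbrs x \<Longrightarrow> x \<in> nbrs y"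
  using edges_coxeter by (metis insert_commute)

lemma automorphism_coxeter_iff:
  "automorphism g \<Gamma> \<longleftrightarrow> bij g \<and> (\<forall>x y. y \<in> nbrs x \<longleftrightarrow> g y \<in> nbrs (g x))"
  by (simp add: automorphism_def isomorphism_def edges_coxeter)

text \<open>When the inverse is given explicitly and preserves adjacency too, reflection of
  adjacency by \<open>g\<close> follows by applying \<open>h\<close>.\<close>

lemma automorphism_coxeterI:
  assumes "\<And>x. h (g x) = x" "\<And>x. g (h x) = x"
    and g: "\<And>x y. y \<in> nbrs x \<Longrightarrow> g y \<in> nbrs (g x)"
    and h: "\<And>x y. y \<in> nbrs x \<Longrightarrow> h y \<in> nbrs (h x)"
  shows "automorphism g \<Gamma>"
  unfolding automorphism_coxeter_iff
proof (intro conjI allI iffI)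
  show "bij g"
    using assms(1,2) by (intro o_bij[of h]) auto
  show "y \<in> nbrs x" if "g y \<in> nbrs (g x)" for x y
    using h[OF that] by (simp add: assms(1))
qed (rule g)

lemma automorphism_comp:
  "automorphism g \<Gamma> \<Longrightarrow> automorphism h \<Gamma> \<Longrightarrow> automorphism (g \<circ> h) \<Gamma>"
  unfolding automorphism_coxeter_iff by (simp add: bij_comp)

lemma automorphism_inv:
  assumes "automorphism g \<Gamma>"
  shows "automorphism (inv g) \<Gamma>"
  using isomorphism_inv_into[of g \<Gamma> \<Gamma>] assms by (simp add: automorphism_def)

section \<open>Explicit automorphisms\<close>

fun shift :: "7 \<Rightarrow> coxeter_vertex \<Rightarrow> coxeter_vertex" where
  "shift k (U x) = U (x + k)"
| "shift k (V x) = V (x + k)"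
| "shift k (T x) = T (x + k)"
| "shift k (Z x) = Z (x + k)"

fun negate :: "coxeter_vertex \<Rightarrow> coxeter_vertex" where
  "negate (U x) = U (- x)"
| "negate (V x) = V (- x)"
| "negate (T x) = T (- x)"
| "negate (Z x) = Z (- x)"

text \<open>Doubling the index multiplies the steps 1, 2, 3 of the three cycles by 2. Up to sign
  this gives 2, 3, 1 modulo 7, so the families must be rotated from \<open>U\<close> to
  \<open>V\<close> to \<open>T\<close> and back to \<open>U\<close>.\<close>

fun double :: "coxeter_vertex \<Rightarrow> coxeter_vertex" where
  "double (U x) = V (2 * x)"
| "double (V x) = T (2 * x)"
| "double (T x) = U (2 * x)"
| "double (Z x) = Z (2 * x)"

text \<open>The inverse of \<open>double\<close>: 4 is the inverse of 2 modulo 7.\<close>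

fun halve :: "coxeter_vertex \<Rightarrow> coxeter_vertex" where
  "halve (V x) = U (4 * x)"
| "halve (T x) = V (4 * x)"
| "halve (U x) = T (4 * x)"
| "halve (Z x) = Z (4 * x)"

text \<open>The unique automorphism that fixes \<open>Z 0\<close>, \<open>U 0\<close>, \<open>U 1\<close> and exchanges \<open>U 2\<close> with \<open>Z 1\<close>,
  found by propagating this condition along the edges.\<close>

definition flip_assocs :: "(coxeter_vertex \<times> coxeter_vertex) list" where
  "flip_assocs =
    [(U 0, U 0), (U 1, U 1), (U 2, Z 1), (U 3, V 1), (U 4, V 6), (U 5, Z 6), (U 6, U 6),
     (V 0, T 0), (V 1, U 3), (V 2, T 4), (V 3, Z 3), (V 4, Z 4), (V 5, T 3), (V 6, U 4),
     (T 0, V 0), (T 1, Z 2), (T 2, T 5), (T 3, V 5), (T 4, V 2), (T 5, T 2), (T 6, Z 5),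
     (Z 0, Z 0), (Z 1, U 2), (Z 2, T 1), (Z 3, V 3), (Z 4, V 4), (Z 5, T 6), (Z 6, U 5)]"

definition flip :: "coxeter_vertex \<Rightarrow> coxeter_vertex" where
  "flip v = the (map_of flip_assocs v)"

lemma automorphism_shift: "automorphism (shift k) \<Gamma>"
proof (rule automorphism_coxeterI[of "shift (- k)"])
  show "y \<in> nbrs x \<Longrightarrow> shift k y \<in> nbrs (shift k x)" for k x y
    by (cases x) (auto simp: algebra_simps)
  then show "y \<in> nbrs x \<Longrightarrow> shift (- k) y \<in> nbrs (shift (- k) x)" for x y .
  show "shift (- k) (shift k x) = x" "shift k (shift (- k) x) = x" for x
    by (cases x; simp)+
qed

lemma automorphism_negate: "automorphism negate \<Gamma>"
proof (rule automorphism_coxeterI[of negate])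
  show "y \<in> nbrs x \<Longrightarrow> negate y \<in> nbrs (negate x)" for x y
    by (cases x) (auto simp: algebra_simps)
  then show "y \<in> nbrs x \<Longrightarrow> negate y \<in> nbrs (negate x)" for x y .
  show "negate (negate x) = x" "negate (negate x) = x" for x
    by (cases x; simp)+
qed

lemma vertex_cases:
  "v \<in> {U 0, U 1, U 2, U 3, U 4, U 5, U 6, V 0, V 1, V 2, V 3, V 4, V 5, V 6,
     T 0, T 1, T 2, T 3, T 4, T 5, T 6, Z 0, Z 1, Z 2, Z 3, Z 4, Z 5, Z 6}"
proof -
  obtain i where "v \<in> {U i, V i, T i, Z i}"
    by (cases v) auto
  moreover have "i \<in> {0, 1, 2, 3, 4, 5, 6}"
    by (rule exhaust_7)
  ultimately show ?thesis
    by (elim insertE emptyE; simp)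
qed

lemma automorphism_double: "automorphism double \<Gamma>"
proof (rule automorphism_coxeterI[of halve])
  have *: "halve (double x) = x \<and> double (halve x) = x \<and>
    (\<forall>y\<in>nbrs x. double y \<in> nbrs (double x) \<and> halve y \<in> nbrs (halve x))" for x
    using vertex_cases[of x] by (elim insertE emptyE; simp)
  show "halve (double x) = x" "double (halve x) = x" for x
    using * by simp_all
  show "y \<in> nbrs x \<Longrightarrow> double y \<in> nbrs (double x)" "y \<in> nbrs x \<Longrightarrow> halve y \<in> nbrs (halve x)" for x y
    using * by simp_all
qed

lemma automorphism_flip: "automorphism flip \<Gamma>"
proof (rule automorphism_coxeterI[of flip])
  have *: "flip (flip x) = x \<and> (\<forall>y\<in>nbrs x. flip y \<in> nbrs (flip x))" for x
    using vertex_cases[of x] by (elim insertE emptyE; simp add: flip_def flip_assocs_def)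
  show "flip (flip x) = x" "flip (flip x) = x" for x
    using * by simp_all
  show "y \<in> nbrs x \<Longrightarrow> flip y \<in> nbrs (flip x)" "y \<in> nbrs x \<Longrightarrow> flip y \<in> nbrs (flip x)" for x y
    using * by simp_all
qed

lemma automorphism_nbrs: "automorphism g \<Gamma> \<Longrightarrow> y \<in> nbrs x \<Longrightarrow> g y \<in> nbrs (g x)"
  and automorphism_eq_iff: "automorphism g \<Gamma> \<Longrightarrow> g x = g y \<longleftrightarrow> x = y"
  by (auto simp: automorphism_coxeter_iff bij_def inj_eq)

section \<open>Transitivity on 3-arcs\<close>

text \<open>Shifts, \<open>negate\<close> and \<open>double\<close> all preserve the family of the
  \<open>Z\<close> vertices. Only \<open>flip\<close> mixes it with the other families, and
  \<open>double\<close> carries \<open>V\<close> over \<open>T\<close> to \<open>U\<close>.\<close>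

lemma normalise_vertex: "\<exists>g. automorphism g \<Gamma> \<and> g a = Z 0"
proof -
  have U: "\<exists>g. automorphism g \<Gamma> \<and> g (U x) = Z 0" for x
  proof (intro exI conjI)
    \<comment> \<open>The first shift moves \<open>U x\<close> to \<open>U 2\<close>, which
      \<open>flip\<close> sends to \<open>Z 1\<close>.\<close>
    show "automorphism (shift (-1) \<circ> flip \<circ> shift (2 - x)) \<Gamma>"
      by (intro automorphism_comp automorphism_shift automorphism_flip)
    have "flip (U 2) = Z 1"
      by (simp add: flip_def flip_assocs_def)
    then show "(shift (-1) \<circ> flip \<circ> shift (2 - x)) (U x) = Z 0"
      by simp
  qed
  have T: "\<exists>g. automorphism g \<Gamma> \<and> g (T x) = Z 0" for x
  proof -
    obtain g where "automorphism g \<Gamma>" "g (U (2 * x)) = Z 0"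
      using U by blast
    then show ?thesis
      by (intro exI[of _ "g \<circ> double"]) (simp add: automorphism_comp automorphism_double)
  qed
  have V: "\<exists>g. automorphism g \<Gamma> \<and> g (V x) = Z 0" for x
  proof -
    obtain g where "automorphism g \<Gamma>" "g (T (2 * x)) = Z 0"
      using T by blast
    then show ?thesis
      by (intro exI[of _ "g \<circ> double"]) (simp add: automorphism_comp automorphism_double)
  qed
  have "\<exists>g. automorphism g \<Gamma> \<and> g (Z x) = Z 0" for x
    by (intro exI[of _ "shift (- x)"]) (simp add: automorphism_shift)
  with U T V show ?thesis
    by (cases a) simp_all
qed

text \<open>\<open>double\<close> fixes \<open>Z 0\<close> and permutes its neighbours cyclically.
  The next two lemmas continue in this way: each time one automorphism fixes the arc normalised so
  far and acts transitively on its possible continuations.\<close>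

lemma normalise_1_arc:
  assumes "b \<in> nbrs a"
  shows "\<exists>g. automorphism g \<Gamma> \<and> g a = Z 0 \<and> g b = U 0"
proof -
  obtain g where g: "automorphism g \<Gamma>" "g a = Z 0"
    using normalise_vertex by blast
  have "g b \<in> {U 0, V 0, T 0}"
    using automorphism_nbrs[OF g(1) assms] by (simp add: g(2))
  then consider "g b = U 0" | "(double \<circ> (double \<circ> g)) b = U 0" | "(double \<circ> g) b = U 0"
    by auto
  moreover have "automorphism (double \<circ> (double \<circ> g)) \<Gamma>" "automorphism (double \<circ> g) \<Gamma>"
    using g by (simp_all add: automorphism_comp automorphism_double)
  moreover have "(double \<circ> (double \<circ> g)) a = Z 0" "(double \<circ> g) a = Z 0"
    using g by simp_all
  ultimately show ?thesis
    using g by metis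
qed

lemma normalise_2_arc:
  assumes "b \<in> nbrs a" "c \<in> nbrs b" "c \<noteq> a"
  shows "\<exists>g. automorphism g \<Gamma> \<and> g a = Z 0 \<and> g b = U 0 \<and> g c = U 1"
proof -
  obtain g where g: "automorphism g \<Gamma>" "g a = Z 0" "g b = U 0"
    using normalise_1_arc[OF assms(1)] by blast
  have "g c \<in> {U 1, U (-1), Z 0}" "g c \<noteq> Z 0"
    using automorphism_nbrs[OF g(1) assms(2)] automorphism_eq_iff[OF g(1), of c a] assms(3)
    by (simp_all add: g(2,3))
  \<comment> \<open>\<open>negate\<close> fixes \<open>Z 0\<close> and \<open>U 0\<close> and
    exchanges the two remaining neighbours of \<open>U 0\<close>.\<close>
  then consider "g c = U 1" | "(negate \<circ> g) c = U 1"
    by auto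
  moreover have "automorphism (negate \<circ> g) \<Gamma>"
    using g by (simp add: automorphism_comp automorphism_negate)
  moreover have "(negate \<circ> g) a = Z 0" "(negate \<circ> g) b = U 0"
    using g by simp_all
  ultimately show ?thesis
    using g by metis
qed

lemma normalise_3_arc:
  assumes "b \<in> nbrs a" "c \<in> nbrs b" "d \<in> nbrs c" "c \<noteq> a" "d \<noteq> b"
  shows "\<exists>g. automorphism g \<Gamma> \<and> g a = Z 0 \<and> g b = U 0 \<and> g c = U 1 \<and> g d = U 2"
proof -
  obtain g where g: "automorphism g \<Gamma>" "g a = Z 0" "g b = U 0" "g c = U 1"
    using normalise_2_arc[OF assms(1,2,4)] by blast
  have "g d \<in> {U 2, U 0, Z 1}" "g d \<noteq> U 0"
    using automorphism_nbrs[OF g(1) assms(3)] automorphism_eq_iff[OF g(1), of d b] assms(5)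
    by (simp_all add: g(3,4))
  then consider "g d = U 2" | "(flip \<circ> g) d = U 2"
    by (auto simp: flip_def flip_assocs_def)
  moreover have "automorphism (flip \<circ> g) \<Gamma>"
    using g by (simp add: automorphism_comp automorphism_flip)
  moreover have "(flip \<circ> g) a = Z 0" "(flip \<circ> g) b = U 0" "(flip \<circ> g) c = U 1"
    using g by (simp_all add: flip_def flip_assocs_def)
  ultimately show ?thesis
    using g by metis
qed

text \<open>Two configurations with the same normal form are matched by
  \<open>inv h \<circ> g\<close>. Quantifying over all pairs with \<open>g x = h y\<close> makes the
  result usable for arcs of every length.\<close>

lemma automorphism_transfer:
  assumes "automorphism g \<Gamma>" "automorphism h \<Gamma>"
  shows "\<exists>f. automorphism f \<Gamma> \<and> (\<forall>x y. g x = h y \<longrightarrow> f x = y)"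
proof (intro exI conjI allI impI)
  show "automorphism (inv h \<circ> g) \<Gamma>"
    using assms by (intro automorphism_comp automorphism_inv)
  have "inj h"
    using assms(2) by (simp add: automorphism_coxeter_iff bij_def)
  then show "(inv h \<circ> g) x = y" if "g x = h y" for x y
    using that by simp
qed

lemma automorphism_edges:
  assumes "automorphism g \<Gamma>" "e \<in> edges \<Gamma>"
  shows "g ` e \<in> edges \<Gamma>"
proof -
  obtain x y where "e = {x, y}"
    using simple_coxeter assms(2) unfolding simple_graph_def by blast
  then show ?thesis
    using assms automorphism_nbrs[OF assms(1)] by (simp add: edges_coxeter)
qed

lemma embedding_automorphism:
  assumes "simple_graph H" "embedding c H \<Gamma>" "automorphism g \<Gamma>"
  shows "embedding (g \<circ> c) H \<Gamma>"
proof -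
  have "inj g"
    using assms(3) by (simp add: automorphism_coxeter_iff bij_def)
  then have "inj_on (g \<circ> c) (verts H)"
    using assms(2) by (auto simp: embedding_def intro: comp_inj_on inj_on_subset)
  moreover have "(g \<circ> c) ` e \<in> edges \<Gamma>" if "e \<in> edges H" for e
  proof -
    have "c ` e \<in> edges \<Gamma>"
      using assms(2) that unfolding embedding_iff[OF assms(1)] by blast
    then show ?thesis
      unfolding image_comp[symmetric] by (rule automorphism_edges[OF assms(3)])
  qed
  ultimately show ?thesis
    unfolding embedding_iff[OF assms(1)] by simp
qed

section \<open>Heptagons through an edge\<close>

lemma minus_7: "(-1::7) = 6" "(-2::7) = 5" "(-3::7) = 4"
  by simp_all

text \<open>Replaces \<open>nbrs.simps\<close> in the path searches, so that neighbours appear with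
  evaluated indices and can be compared directly. The equation for \<open>Z x\<close> involves no
  arithmetic and is kept in symbolic form.\<close>

lemma nbrs_table:
  "nbrs (U 0) = {U 1, U 6, Z 0}" "nbrs (U 1) = {U 2, U 0, Z 1}" "nbrs (U 2) = {U 3, U 1, Z 2}"
  "nbrs (U 3) = {U 4, U 2, Z 3}" "nbrs (U 4) = {U 5, U 3, Z 4}" "nbrs (U 5) = {U 6, U 4, Z 5}"
  "nbrs (U 6) = {U 0, U 5, Z 6}"
  "nbrs (V 0) = {V 2, V 5, Z 0}" "nbrs (V 1) = {V 3, V 6, Z 1}" "nbrs (V 2) = {V 4, V 0, Z 2}"
  "nbrs (V 3) = {V 5, V 1, Z 3}" "nbrs (V 4) = {V 6, V 2, Z 4}" "nbrs (V 5) = {V 0, V 3, Z 5}"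
  "nbrs (V 6) = {V 1, V 4, Z 6}"
  "nbrs (T 0) = {T 3, T 4, Z 0}" "nbrs (T 1) = {T 4, T 5, Z 1}" "nbrs (T 2) = {T 5, T 6, Z 2}"
  "nbrs (T 3) = {T 6, T 0, Z 3}" "nbrs (T 4) = {T 0, T 1, Z 4}" "nbrs (T 5) = {T 1, T 2, Z 5}"
  "nbrs (T 6) = {T 2, T 3, Z 6}"
  by (simp_all add: reduce_7 minus_7)

lemma embedding_cycle_coxeter:
  assumes "embedding c (cycle_graph n) \<Gamma>" "2 \<le> n"
  shows "inj_on c {..<n}" "\<And>i. i < n \<Longrightarrow> c ((i + 1) mod n) \<in> nbrs (c i)"
  using assms(1) unfolding embedding_cycle_iff[OF assms(2)] edges_coxeter by blast+

definition heptagon :: "'a list \<Rightarrow> 'a ugraph" where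
  "heptagon xs = map_graph ((!) xs) (cycle_graph 7)"

lemma simple_cycle_7: "simple_graph (cycle_graph 7)"
  by (rule simple_cycle_graph) simp

lemma heptagon_list:
  "heptagon [a, b, c, d, e, f, g] = \<lparr>verts = {a, b, c, d, e, f, g},
    edges = {{a, b}, {b, c}, {c, d}, {d, e}, {e, f}, {f, g}, {g, a}}\<rparr>"
  by (simp add: heptagon_def map_graph_def cycle_7)

lemma map_graph_cycle_7:
  "map_graph c (cycle_graph 7) = heptagon [c 0, c 1, c 2, c 3, c 4, c 5, c 6]"
  unfolding heptagon_list by (simp add: map_graph_def cycle_7)

text \<open>All four arise from \<open>hept1\<close>: \<open>flip\<close> maps it to
  \<open>hept2\<close>, and \<open>negate\<close> maps these two to \<open>hept3\<close> and
  \<open>hept4\<close>. The graph of \<open>hept1\<close> meets that of \<open>hept2\<close> in the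
  path \<open>Z 0\<close>, \<open>U 0\<close>, \<open>U 1\<close>, that of \<open>hept3\<close> in
  the path \<open>V 0\<close>, \<open>Z 0\<close>, \<open>U 0\<close>, and that of
  \<open>hept4\<close> in the edge only.\<close>

abbreviation "hept1 \<equiv> [Z 0, U 0, U 1, U 2, Z 2, V 2, V 0]"
abbreviation "hept2 \<equiv> [Z 0, U 0, U 1, Z 1, T 1, T 4, T 0]"
abbreviation "hept3 \<equiv> [Z 0, U 0, U 6, U 5, Z 5, V 5, V 0]"
abbreviation "hept4 \<equiv> [Z 0, U 0, U 6, Z 6, T 6, T 3, T 0]"

text \<open>A search over non-backtracking walks: there are 16 choices for \<open>c 2\<close> to
  \<open>c 5\<close>, and only four of them can be closed up through a neighbour of
  \<open>Z 0\<close>.\<close>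

lemma heptagon_cases:
  assumes c: "embedding c (cycle_graph 7) \<Gamma>" and start: "c 0 = Z 0" "c 1 = U 0"
  shows "[c 0, c 1, c 2, c 3, c 4, c 5, c 6] \<in> {hept1, hept2, hept3, hept4}"
proof -
  note c = embedding_cycle_coxeter[OF c, simplified]
  have ne: "c 2 \<noteq> c 0" "c 3 \<noteq> c 1" "c 4 \<noteq> c 2" "c 5 \<noteq> c 3" "c 6 \<noteq> c 4"
    using c(1) by (simp_all add: inj_on_eq_iff)
  have adj: "c 2 \<in> nbrs (c 1)" "c 3 \<in> nbrs (c 2)" "c 4 \<in> nbrs (c 3)" "c 5 \<in> nbrs (c 4)"
    "c 6 \<in> nbrs (c 5)" "c 0 \<in> nbrs (c 6)"
    using c(2)[of 1] c(2)[of 2] c(2)[of 3] c(2)[of 4] c(2)[of 5] c(2)[of 6]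
    by (simp_all add: numeral_2_eq_2)
  note [simp del] = nbrs.simps
  note [simp] = nbrs_table nbrs.simps(4)
  \<comment> \<open>The closing edge, read backwards from \<open>Z 0\<close>; it prunes the 16
    branches at the end.\<close>
  have last: "c 6 \<in> {U 0, V 0, T 0}"
    using nbrs_sym[OF adj(6)] start by simp
  have "c 2 = U 1 \<or> c 2 = U 6"
    using adj(1) ne(1) start by simp
  then have "(c 2, c 3) \<in>
    {(U 1, U 2), (U 1, Z 1), (U 6, U 5), (U 6, Z 6)}"
    using adj(2) ne(2) start by (elim disjE insertE emptyE) simp_all
  then have "(c 2, c 3, c 4) \<in>
    {(U 1, U 2, U 3), (U 1, U 2, Z 2), (U 1, Z 1, V 1), (U 1, Z 1, T 1),
     (U 6, U 5, U 4), (U 6, U 5, Z 5), (U 6, Z 6, V 6), (U 6, Z 6, T 6)}"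
    using adj(3) ne(3) start by (elim disjE insertE emptyE) simp_all
  then have "(c 2, c 3, c 4, c 5) \<in>
    {(U 1, U 2, U 3, U 4), (U 1, U 2, U 3, Z 3), (U 1, U 2, Z 2, V 2),
     (U 1, U 2, Z 2, T 2), (U 1, Z 1, V 1, V 3), (U 1, Z 1, V 1, V 6),
     (U 1, Z 1, T 1, T 4), (U 1, Z 1, T 1, T 5), (U 6, U 5, U 4, U 3),
     (U 6, U 5, U 4, Z 4), (U 6, U 5, Z 5, V 5), (U 6, U 5, Z 5, T 5),
     (U 6, Z 6, V 6, V 1), (U 6, Z 6, V 6, V 4), (U 6, Z 6, T 6, T 2),
     (U 6, Z 6, T 6, T 3)}"
    using adj(4) ne(4) start by (elim disjE insertE emptyE) simp_all
  then show ?thesis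
    using adj(5) ne(5) last start by (elim insertE emptyE) simp_all
qed

lemma heptagon_unique:
  assumes c: "embedding c (cycle_graph 7) \<Gamma>" and c': "embedding c' (cycle_graph 7) \<Gamma>"
    and eq: "\<And>i. i < 4 \<Longrightarrow> c i = c' i" and "i < 7"
  shows "c i = c' i"
proof -
  note d = embedding_cycle_coxeter[OF c, simplified]
  have "c 1 \<in> nbrs (c 0)" "c 2 \<in> nbrs (c 1)" "c 3 \<in> nbrs (c 2)" "c 2 \<noteq> c 0" "c 3 \<noteq> c 1"
    using d(1) d(2)[of 0] d(2)[of 1] d(2)[of 2] by (simp_all add: inj_on_eq_iff numeral_2_eq_2)
  from normalise_3_arc[OF this] obtain g where
    g: "automorphism g \<Gamma>" "g (c 0) = Z 0" "g (c 1) = U 0" "g (c 2) = U 1" "g (c 3) = U 2"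
    by blast
  have g': "g (c' 0) = Z 0" "g (c' 1) = U 0" "g (c' 2) = U 1" "g (c' 3) = U 2"
    using g eq[of 0] eq[of 1] eq[of 2] eq[of 3] by simp_all
  have "[(g \<circ> c) 0, (g \<circ> c) 1, (g \<circ> c) 2, (g \<circ> c) 3, (g \<circ> c) 4, (g \<circ> c) 5, (g \<circ> c) 6]
      \<in> {hept1, hept2, hept3, hept4}"
    using g by (intro heptagon_cases embedding_automorphism simple_cycle_7 c) simp_all
  moreover have "[(g \<circ> c') 0, (g \<circ> c') 1, (g \<circ> c') 2, (g \<circ> c') 3, (g \<circ> c') 4, (g \<circ> c') 5, (g \<circ> c') 6]
      \<in> {hept1, hept2, hept3, hept4}"
    using g g' by (intro heptagon_cases embedding_automorphism simple_cycle_7 c') simp_all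
  \<comment> \<open>Only \<open>hept1\<close> continues with \<open>U 1\<close>, \<open>U 2\<close>,
    so both normalised lists are \<open>hept1\<close>.\<close>
  ultimately have "g (c 4) = g (c' 4)" "g (c 5) = g (c' 5)" "g (c 6) = g (c' 6)"
    using g g' by simp_all
  then have "c 4 = c' 4" "c 5 = c' 5" "c 6 = c' 6"
    using automorphism_eq_iff[OF g(1)] by simp_all
  moreover have "i < 4 \<or> i = 4 \<or> i = 5 \<or> i = 6"
    using \<open>i < 7\<close> by auto
  ultimately show ?thesis
    using eq by auto
qed

section \<open>Ultrahomogeneity\<close>

lemma heptagon_extends:
  assumes c: "embedding c (cycle_graph 7) \<Gamma>" and c': "embedding c' (cycle_graph 7) \<Gamma>"
  obtains g where "automorphism g \<Gamma>" "\<And>i. i < 7 \<Longrightarrow> g (c i) = c' i"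
proof -
  have *: "\<exists>g. automorphism g \<Gamma> \<and> g (c 0) = Z 0 \<and> g (c 1) = U 0 \<and> g (c 2) = U 1 \<and> g (c 3) = U 2"
    if "embedding c (cycle_graph 7) \<Gamma>" for c
  proof -
    note d = embedding_cycle_coxeter[OF that, simplified]
    have "c 1 \<in> nbrs (c 0)" "c 2 \<in> nbrs (c 1)" "c 3 \<in> nbrs (c 2)" "c 2 \<noteq> c 0" "c 3 \<noteq> c 1"
      using d(1) d(2)[of 0] d(2)[of 1] d(2)[of 2] by (simp_all add: inj_on_eq_iff numeral_2_eq_2)
    then show ?thesis
      by (rule normalise_3_arc)
  qed
  obtain g h where gh: "automorphism g \<Gamma>" "automorphism h \<Gamma>"
      "g (c 0) = h (c' 0)" "g (c 1) = h (c' 1)" "g (c 2) = h (c' 2)" "g (c 3) = h (c' 3)"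
    using *[OF c] *[OF c'] by auto
  obtain f where f: "automorphism f \<Gamma>" "\<And>x y. g x = h y \<Longrightarrow> f x = y"
    using automorphism_transfer[OF gh(1,2)] by blast
  have eq: "(f \<circ> c) i = c' i" if "i < 4" for i
  proof -
    have "i = 0 \<or> i = 1 \<or> i = 2 \<or> i = 3"
      using that by auto
    then show ?thesis
      using f(2) gh by auto
  qed
  have "f (c i) = c' i" if "i < 7" for i
    using heptagon_unique[OF embedding_automorphism[OF simple_cycle_7 c f(1)] c' eq that] by simp
  with f(1) show thesis
    by (rule that)
qed

lemma ultrahomogeneous_C7: "ultrahomogeneous (cycle_graph 7) \<Gamma>"
proof (rule ultrahomogeneousI[OF simple_cycle_7])
  fix c c' assume "embedding c (cycle_graph 7) \<Gamma>" "embedding c' (cycle_graph 7) \<Gamma>"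
  then obtain g where "automorphism g \<Gamma>" "\<And>i. i < 7 \<Longrightarrow> g (c i) = c' i"
    using heptagon_extends by blast
  then show "\<exists>g. automorphism g \<Gamma> \<and> (\<forall>x\<in>verts (cycle_graph 7). g (c x) = c' x)"
    by (auto simp: cycle_graph_def)
qed

lemma embedding_path_2_iff:
  "embedding c (path_graph 2) G \<longleftrightarrow>
    c 0 \<noteq> c 1 \<and> {c 0, c 1} \<subseteq> verts G \<and> {c 0, c 1} \<in> edges G"
  unfolding embedding_iff[OF simple_path_graph] by (auto simp: path_2)

lemma embedding_path_3_iff:
  "embedding c (path_graph 3) G \<longleftrightarrow>
    c 0 \<noteq> c 1 \<and> c 0 \<noteq> c 2 \<and> c 1 \<noteq> c 2 \<and> {c 0, c 1, c 2} \<subseteq> verts G \<and>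
    {c 0, c 1} \<in> edges G \<and> {c 1, c 2} \<in> edges G"
  unfolding embedding_iff[OF simple_path_graph] by (auto simp: path_3)

lemma ultrahomogeneous_P2: "ultrahomogeneous (path_graph 2) \<Gamma>"
proof (rule ultrahomogeneousI[OF simple_path_graph])
  fix c c' assume "embedding c (path_graph 2) \<Gamma>" "embedding c' (path_graph 2) \<Gamma>"
  then have "c 1 \<in> nbrs (c 0)" "c' 1 \<in> nbrs (c' 0)"
    unfolding embedding_path_2_iff edges_coxeter by blast+
  from normalise_1_arc[OF this(1)] normalise_1_arc[OF this(2)] obtain g h where
    gh: "automorphism g \<Gamma>" "automorphism h \<Gamma>" "g (c 0) = h (c' 0)" "g (c 1) = h (c' 1)"
    by auto
  with automorphism_transfer[OF gh(1,2)]
  show "\<exists>g. automorphism g \<Gamma> \<and> (\<forall>x\<in>verts (path_graph 2). g (c x) = c' x)"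
    by (simp add: path_2) blast
qed

lemma ultrahomogeneous_P3: "ultrahomogeneous (path_graph 3) \<Gamma>"
proof (rule ultrahomogeneousI[OF simple_path_graph])
  fix c c' assume "embedding c (path_graph 3) \<Gamma>" "embedding c' (path_graph 3) \<Gamma>"
  then have "c 1 \<in> nbrs (c 0)" "c 2 \<in> nbrs (c 1)" "c 2 \<noteq> c 0"
      and "c' 1 \<in> nbrs (c' 0)" "c' 2 \<in> nbrs (c' 1)" "c' 2 \<noteq> c' 0"
    unfolding embedding_path_3_iff edges_coxeter by metis+
  from normalise_2_arc[OF this(1-3)] normalise_2_arc[OF this(4-6)] obtain g h where
    gh: "automorphism g \<Gamma>" "automorphism h \<Gamma>"
      "g (c 0) = h (c' 0)" "g (c 1) = h (c' 1)" "g (c 2) = h (c' 2)"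
    by auto
  with automorphism_transfer[OF gh(1,2)]
  show "\<exists>g. automorphism g \<Gamma> \<and> (\<forall>x\<in>verts (path_graph 3). g (c x) = c' x)"
    by (simp add: path_3) blast
qed

section \<open>Transport of copies along automorphisms\<close>

lemma map_graph_id [simp]: "map_graph id G = G"
  by (simp add: map_graph_def)

lemma map_graph_inv_cancel:
  assumes "bij g"
  shows "map_graph (inv g) (map_graph g K) = K" "map_graph g (map_graph (inv g) L) = L"
  using assms by (simp_all add: map_graph_comp bij_is_inj bij_is_surj surj_iff[THEN iffD1])

lemma inj_map_graph: "bij g \<Longrightarrow> inj (map_graph g)"
  by (rule inj_on_inverseI[of _ "map_graph (inv g)"]) (erule map_graph_inv_cancel)

lemma map_graph_inter:
  assumes "inj g"
  shows "graph_inter (map_graph g A) (map_graph g B) = map_graph g (graph_inter A B)"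
proof -
  have inj: "inj ((`) g)"
    by (rule injI) (simp only: inj_image_eq_iff[OF assms])
  show ?thesis
    by (simp add: graph_inter_def map_graph_def image_Int[OF assms] image_Int[OF inj])
qed

lemma subgraph_map_graph:
  assumes "inj g" "subgraph A B"
  shows "subgraph (map_graph g A) (map_graph g B)"
  using assms simple_map_graph[of A g] inj_on_subset[OF assms(1) subset_UNIV]
  by (simp add: subgraph_def image_mono)

lemma map_graph_copies:
  assumes "simple_graph H" "automorphism g \<Gamma>" "K \<in> copies H \<Gamma>"
  shows "map_graph g K \<in> copies H \<Gamma>"
proof -
  obtain c where "embedding c H \<Gamma>" "K = map_graph c H"
    using assms(3) unfolding copies_eq[OF assms(1)] by blast
  then have "embedding (g \<circ> c) H \<Gamma>" "map_graph g K = map_graph (g \<circ> c) H"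
    using embedding_automorphism[OF assms(1) _ assms(2)] by (simp_all add: map_graph_comp)
  then show ?thesis
    unfolding copies_eq[OF assms(1)] by blast
qed

lemma map_graph_other_copies:
  assumes "simple_graph H" "automorphism g \<Gamma>"
  shows "other_copies H \<Gamma> (map_graph g H0) (map_graph g M0) = map_graph g ` other_copies H \<Gamma> H0 M0"
proof -
  \<comment> \<open>Stated for arbitrary \<open>g\<close>, \<open>H0\<close> and \<open>M0\<close>,
    so that the reverse inclusion is the same fact applied to \<open>inv g\<close>.\<close>
  have sub: "map_graph g K \<in> other_copies H \<Gamma> (map_graph g H0) (map_graph g M0)"
    if g: "automorphism g \<Gamma>" and K: "K \<in> other_copies H \<Gamma> H0 M0" for g K H0 M0
  proof -
    have "bij g"
      using g by (simp add: automorphism_coxeter_iff)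
    then have inj: "inj g" "inj (map_graph g)"
      by (simp_all add: bij_is_inj inj_map_graph)
    have "subgraph (map_graph g M0) (graph_inter (map_graph g K) (map_graph g H0))"
      unfolding map_graph_inter[OF inj(1)]
      using K by (intro subgraph_map_graph inj) (simp add: other_copies_def)
    then show ?thesis
      using K map_graph_copies[OF assms(1) g] inj(2) by (auto simp: other_copies_def inj_eq)
  qed
  have g: "bij g"
    using assms(2) by (simp add: automorphism_coxeter_iff)
  show ?thesis
  proof (intro equalityI subsetI)
    fix K assume "K \<in> other_copies H \<Gamma> (map_graph g H0) (map_graph g M0)"
    from sub[OF automorphism_inv[OF assms(2)] this]
    have "map_graph (inv g) K \<in> other_copies H \<Gamma> H0 M0"
      by (simp add: map_graph_inv_cancel g)
    then show "K \<in> map_graph g ` other_copies H \<Gamma> H0 M0"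
      by (rule rev_image_eqI) (simp add: map_graph_inv_cancel g)
  qed (use sub[OF assms(2)] in blast)
qed

lemma embedding_heptagons:
  assumes "xs \<in> {hept1, hept2, hept3, hept4}"
  shows "embedding ((!) xs) (cycle_graph 7) \<Gamma>"
proof -
  note [simp del] = nbrs.simps
  note [simp] = nbrs_table nbrs.simps(4)
  show ?thesis
    using assms unfolding embedding_iff[OF simple_cycle_7]
    by (elim insertE emptyE) (simp_all add: cycle_7 edges_coxeter)
qed

lemma heptagons_through_edge:
  "{K \<in> copies (cycle_graph 7) \<Gamma>. {Z 0, U 0} \<in> edges K} =
    {heptagon hept1, heptagon hept2, heptagon hept3, heptagon hept4}"
proof (intro equalityI subsetI)
  fix K assume "K \<in> {K \<in> copies (cycle_graph 7) \<Gamma>. {Z 0, U 0} \<in> edges K}"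
  then have K: "K \<in> copies (cycle_graph 7) \<Gamma>" "{Z 0, U 0} \<in> edges K"
    by simp_all
  then have "simple_graph K"
    by (simp add: copies_def subgraph_def)
  \<comment> \<open>Only the values at 0 and 1 matter; every other argument gets \<open>U 0\<close>
    as a default.\<close>
  define d where "d i = (if i = 0 then Z 0 else U 0)" for i :: nat
  have "{d 0, d 1} \<subseteq> verts K"
    using simple_graph_edge_subset[OF \<open>simple_graph K\<close> K(2)] by (simp add: d_def)
  then have "embedding d (path_graph 2) K"
    using K(2) by (simp add: embedding_path_2_iff d_def)
  then obtain c where c: "embedding c (cycle_graph 7) \<Gamma>" "K = map_graph c (cycle_graph 7)"
      "\<And>i. i < 2 \<Longrightarrow> c i = d i"
    using copies_cycle_path[OF _ K(1), of 2 d] by metis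
  have "[c 0, c 1, c 2, c 3, c 4, c 5, c 6] \<in> {hept1, hept2, hept3, hept4}"
    using c(3)[of 0] c(3)[of 1] by (intro heptagon_cases c(1)) (simp_all add: d_def)
  from imageI[OF this, of heptagon]
  show "K \<in> {heptagon hept1, heptagon hept2, heptagon hept3, heptagon hept4}"
    unfolding c(2) map_graph_cycle_7 by (simp only: image_insert image_empty)
next
  fix K assume "K \<in> {heptagon hept1, heptagon hept2, heptagon hept3, heptagon hept4}"
  then obtain xs where xs: "xs \<in> {hept1, hept2, hept3, hept4}" "K = heptagon xs"
    by blast
  then have "K \<in> copies (cycle_graph 7) \<Gamma>"
    using embedding_heptagons unfolding copies_eq[OF simple_cycle_7] heptagon_def by blast
  moreover have "{Z 0, U 0} \<in> edges K"
    using xs by (elim insertE emptyE) (simp_all add: heptagon_list)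
  ultimately show "K \<in> {K \<in> copies (cycle_graph 7) \<Gamma>. {Z 0, U 0} \<in> edges K}"
    by simp
qed

lemma heptagons_distinct:
  "heptagon hept1 \<noteq> heptagon hept2" "heptagon hept1 \<noteq> heptagon hept3"
  "heptagon hept1 \<noteq> heptagon hept4" "heptagon hept2 \<noteq> heptagon hept3"
  "heptagon hept2 \<noteq> heptagon hept4" "heptagon hept3 \<noteq> heptagon hept4"
proof -
  have *: "A \<noteq> B" if "v \<in> verts A" "v \<notin> verts B" for v and A B :: "coxeter_vertex ugraph"
    using that by blast
  show "heptagon hept1 \<noteq> heptagon hept2" "heptagon hept1 \<noteq> heptagon hept3"
      "heptagon hept1 \<noteq> heptagon hept4"
    \<comment> \<open>Among the four heptagons, \<open>U 2\<close> lies only on the first;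
      \<open>T 1\<close> and \<open>U 5\<close> below likewise single out the second and the
      third.\<close>
    by (rule *[of "U 2"]; simp add: heptagon_list)+
  show "heptagon hept2 \<noteq> heptagon hept3" "heptagon hept2 \<noteq> heptagon hept4"
    by (rule *[of "T 1"]; simp add: heptagon_list)+
  show "heptagon hept3 \<noteq> heptagon hept4"
    by (rule *[of "U 5"]; simp add: heptagon_list)
qed

text \<open>Both paths contain the edge between \<open>Z 0\<close> and \<open>U 0\<close>, so every
  copy through them is among the four known heptagons. What remains is a comparison of edge
  sets.\<close>

lemma other_copies_path:
  assumes "k = 2 \<or> k = 3"
  shows "other_copies (cycle_graph 7) \<Gamma> (heptagon hept1) (map_graph ((!) hept1) (path_graph k)) =
    {K \<in> {heptagon hept2, heptagon hept3, heptagon hept4}.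
      edges (map_graph ((!) hept1) (path_graph k)) \<subseteq> edges K}"
    (is "other_copies _ _ _ ?M = ?R")
proof -
  have edge: "{Z 0, U 0} \<in> edges ?M"
    using assms by (elim disjE) (simp_all add: path_2 path_3)
  have "inj_on ((!) hept1) (verts (path_graph k))"
    using assms by (elim disjE) (simp_all add: path_2 path_3)
  then have M: "simple_graph ?M"
    by (rule simple_map_graph[OF simple_path_graph])
  have sub: "verts ?M \<subseteq> verts (heptagon hept1)" "edges ?M \<subseteq> edges (heptagon hept1)"
    using assms by (elim disjE; simp add: path_2 path_3 heptagon_list)+
  \<comment> \<open>The path has no isolated vertices, so a simple graph that contains its edges
    also contains its vertices.\<close>
  have Union: "verts ?M = \<Union> (edges ?M)"
    using assms by (elim disjE) (simp_all add: path_2 path_3 insert_commute)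
  have sub_iff: "subgraph ?M (graph_inter K (heptagon hept1)) \<longleftrightarrow> edges ?M \<subseteq> edges K"
    if "K \<in> copies (cycle_graph 7) \<Gamma>" for K
  proof -
    have "simple_graph K"
      using that by (simp add: copies_def subgraph_def)
    then have "verts ?M \<subseteq> verts K" if "edges ?M \<subseteq> edges K"
      unfolding Union using simple_graph_edge_subset that by (intro Union_least) blast
    then show ?thesis
      using M sub unfolding subgraph_def graph_inter_def ugraph.select_convs by (meson le_inf_iff)
  qed
  have four: "K \<in> copies (cycle_graph 7) \<Gamma> \<and> {Z 0, U 0} \<in> edges K \<longleftrightarrow>
      K \<in> {heptagon hept1, heptagon hept2, heptagon hept3, heptagon hept4}" for K
    unfolding heptagons_through_edge[symmetric] by simp
  have "K \<in> other_copies (cycle_graph 7) \<Gamma> (heptagon hept1) ?M \<longleftrightarrow> K \<in> ?R" for K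
  proof -
    have "K \<in> other_copies (cycle_graph 7) \<Gamma> (heptagon hept1) ?M \<longleftrightarrow>
        (K \<in> copies (cycle_graph 7) \<Gamma> \<and> {Z 0, U 0} \<in> edges K) \<and> K \<noteq> heptagon hept1 \<and>
        edges ?M \<subseteq> edges K"
      unfolding other_copies_def using sub_iff[of K] edge by blast
    also have "\<dots> \<longleftrightarrow> K \<in> ?R"
      unfolding four using heptagons_distinct(1-3) by (simp del: edges_map_graph) metis
    finally show ?thesis .
  qed
  then show ?thesis
    by (rule set_eqI)
qed

lemma other_copies_path_2:
  "other_copies (cycle_graph 7) \<Gamma> (heptagon hept1) (map_graph ((!) hept1) (path_graph 2)) =
    {heptagon hept2, heptagon hept3, heptagon hept4}"
proof -
  have restrict: "P a \<Longrightarrow> P b \<Longrightarrow> P c \<Longrightarrow> {x \<in> {a, b, c}. P x} = {a, b, c}" for P :: "'a \<Rightarrow> bool" and a b c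
    by blast
  show ?thesis
    unfolding other_copies_path[OF disjI1[OF refl]]
    by (rule restrict; simp add: path_2 heptagon_list)
qed

text \<open>The third and fourth heptagons leave \<open>U 0\<close> towards \<open>U 6\<close> and
  so miss the edge from \<open>U 0\<close> to \<open>U 1\<close>.\<close>

lemma other_copies_path_3:
  "other_copies (cycle_graph 7) \<Gamma> (heptagon hept1) (map_graph ((!) hept1) (path_graph 3)) =
    {heptagon hept2}"
proof -
  have restrict: "P a \<Longrightarrow> \<not> P b \<Longrightarrow> \<not> P c \<Longrightarrow> {x \<in> {a, b, c}. P x} = {a}" for P :: "'a \<Rightarrow> bool" and a b c
    by blast
  show ?thesis
    unfolding other_copies_path[OF disjI2[OF refl]]
    by (rule restrict; simp add: path_3 heptagon_list doubleton_eq_iff)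
qed

text \<open>These are the witnesses for the clause of fastening that asks for an intersection equal
  to the given path.\<close>

lemma heptagons_inter:
  "graph_inter (heptagon hept2) (heptagon hept1) = map_graph ((!) hept1) (path_graph 3)"
  "graph_inter (heptagon hept4) (heptagon hept1) = map_graph ((!) hept1) (path_graph 2)"
  by (simp_all add: graph_inter_def heptagon_list map_graph_def path_2 path_3 doubleton_eq_iff)

section \<open>Fastening\<close>

text \<open>Automorphisms act transitively on pairs of a heptagon and a path with \<open>k\<close>
  vertices in it, and they preserve both the number of other copies and all intersections. One
  standard pair therefore suffices.\<close>

lemma fastened_UH_coxeter:
  assumes k: "k = 2 \<or> k = 3"
    and std: "card (other_copies (cycle_graph 7) \<Gamma> (heptagon hept1) (map_graph ((!) hept1) (path_graph k))) = l"
      "\<exists>H1\<in>other_copies (cycle_graph 7) \<Gamma> (heptagon hept1) (map_graph ((!) hept1) (path_graph k)).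
        graph_inter H1 (heptagon hept1) = map_graph ((!) hept1) (path_graph k)"
    and "1 \<le> l"
  shows "fastened_UH l (cycle_graph 7) (path_graph k) \<Gamma>"
  unfolding fastened_UH_def
proof (intro conjI ballI)
  show "subgraph (path_graph k) (cycle_graph 7)"
    unfolding subgraph_def using k
    by (intro conjI simple_path_graph; elim disjE; simp add: path_2 path_3 cycle_7)
  show "1 \<le> l" by fact
  show "ultrahomogeneous (path_graph k) \<Gamma>"
    using k ultrahomogeneous_P2 ultrahomogeneous_P3 by blast
  show "ultrahomogeneous (cycle_graph 7) \<Gamma>"
    by (rule ultrahomogeneous_C7)
next
  fix H0 M0 assume H0: "H0 \<in> copies (cycle_graph 7) \<Gamma>" and M0: "M0 \<in> copies (path_graph k) H0"
  let ?H = "heptagon hept1" and ?M = "map_graph ((!) hept1) (path_graph k)"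
  obtain g where g: "automorphism g \<Gamma>" "H0 = map_graph g ?H" "M0 = map_graph g ?M"
  proof -
    obtain d where d: "embedding d (path_graph k) H0" "M0 = map_graph d (path_graph k)"
      using M0 unfolding copies_eq[OF simple_path_graph] by blast
    \<comment> \<open>The path is an initial segment of \<open>c\<close>, so the automorphism taking
      \<open>hept1\<close> to \<open>c\<close> moves the heptagon and the path
      simultaneously.\<close>
    obtain c where c: "embedding c (cycle_graph 7) \<Gamma>" "H0 = map_graph c (cycle_graph 7)"
        "\<And>i. i < k \<Longrightarrow> c i = d i"
      using copies_cycle_path[OF k H0 d(1)] by metis
    obtain g where g: "automorphism g \<Gamma>" "\<And>i. i < 7 \<Longrightarrow> g (hept1 ! i) = c i"
      using heptagon_extends[OF embedding_heptagons[OF insertI1] c(1)] by blast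
    have "H0 = map_graph g ?H"
      unfolding c(2) heptagon_def map_graph_comp comp_def
      by (rule map_graph_cong[OF simple_cycle_7], rule g(2)[symmetric]) (simp add: cycle_graph_def)
    moreover have "M0 = map_graph g ?M"
      unfolding d(2) map_graph_comp comp_def
    proof (rule map_graph_cong[OF simple_path_graph])
      fix i assume "i \<in> verts (path_graph k)"
      then have "i < k" "i < 7"
        using k by (elim disjE; simp add: path_graph_def)+
      then show "d i = g (hept1 ! i)"
        by (simp only: g(2) c(3))
    qed
    ultimately show thesis
      by (rule that[OF g(1)])
  qed
  have bij: "bij g"
    using g(1) by (simp add: automorphism_coxeter_iff)
  have eq: "other_copies (cycle_graph 7) \<Gamma> H0 M0 = map_graph g ` other_copies (cycle_graph 7) \<Gamma> ?H ?M"
    unfolding g(2,3) by (rule map_graph_other_copies[OF simple_cycle_7 g(1)])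
  show "card (other_copies (cycle_graph 7) \<Gamma> H0 M0) = l"
    unfolding eq std(1)[symmetric]
    by (rule card_image[OF inj_on_subset[OF inj_map_graph[OF bij] subset_UNIV]])
  obtain H1 where H1: "H1 \<in> other_copies (cycle_graph 7) \<Gamma> ?H ?M" "graph_inter H1 ?H = ?M"
    using std(2) by blast
  have "graph_inter (map_graph g H1) H0 = M0"
    unfolding g(2,3) map_graph_inter[OF bij_is_inj[OF bij]] H1(2) ..
  with H1(1) show "\<exists>H1\<in>other_copies (cycle_graph 7) \<Gamma> H0 M0. graph_inter H1 H0 = M0"
    unfolding eq by blast
qed

lemma fastened_UH_P3: "fastened_UH 1 (cycle_graph 7) (path_graph 3) \<Gamma>"
  by (rule fastened_UH_coxeter) (simp_all add: other_copies_path_3 heptagons_inter del: edges_map_graph)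

lemma fastened_UH_P2: "fastened_UH 3 (cycle_graph 7) (path_graph 2) \<Gamma>"
  by (rule fastened_UH_coxeter) (simp_all add: other_copies_path_2 heptagons_inter heptagons_distinct)

section \<open>Counting\<close>

lemma UNIV_coxeter_vertex: "(UNIV :: coxeter_vertex set) =
  {U 0, U 1, U 2, U 3, U 4, U 5, U 6, V 0, V 1, V 2, V 3, V 4, V 5, V 6,
   T 0, T 1, T 2, T 3, T 4, T 5, T 6, Z 0, Z 1, Z 2, Z 3, Z 4, Z 5, Z 6}"
  using vertex_cases by (intro equalityI subsetI UNIV_I)

lemma finite_coxeter_vertices: "finite (UNIV :: coxeter_vertex set)"
  unfolding UNIV_coxeter_vertex by simp

lemma card_coxeter_vertices: "card (UNIV :: coxeter_vertex set) = 28"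
  unfolding UNIV_coxeter_vertex by simp

lemma finite_coxeter_edges: "finite (edges \<Gamma>)"
proof (rule finite_subset)
  show "edges \<Gamma> \<subseteq> Pow UNIV"
    by simp
  show "finite (Pow (UNIV :: coxeter_vertex set))"
    unfolding finite_Pow_iff by (rule finite_coxeter_vertices)
qed

lemma card_nbrs: "card (nbrs x) = 3"
  using vertex_cases[of x] by (elim insertE emptyE; simp)

lemma incident_edges: "{e \<in> edges \<Gamma>. x \<in> e} = (\<lambda>y. {x, y}) ` nbrs x"
proof (intro equalityI subsetI)
  fix e assume "e \<in> {e \<in> edges \<Gamma>. x \<in> e}"
  then have e: "e \<in> edges \<Gamma>" "x \<in> e"
    by simp_all
  obtain a b where ab: "e = {a, b}"
    using simple_coxeter e(1) unfolding simple_graph_def by blast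
  then have "x = a \<or> x = b" "{a, b} = {b, a}"
    using e(2) by auto
  with ab obtain y where "e = {x, y}"
    by metis
  moreover from this e(1) have "y \<in> nbrs x"
    by (simp add: edges_coxeter)
  ultimately show "e \<in> (\<lambda>y. {x, y}) ` nbrs x"
    by (rule image_eqI)
next
  fix e assume "e \<in> (\<lambda>y. {x, y}) ` nbrs x"
  then show "e \<in> {e \<in> edges \<Gamma>. x \<in> e}"
    by (elim imageE) (simp add: edges_coxeter)
qed

lemma card_incident_edges: "card {e \<in> edges \<Gamma>. x \<in> e} = 3"
proof -
  have "inj_on (\<lambda>y. {x, y}) (nbrs x)"
    by (rule inj_onI) (auto simp: doubleton_eq_iff)
  then show ?thesis
    unfolding incident_edges by (simp only: card_image card_nbrs)
qed

text \<open>The comprehension over \<open>UNIV\<close> is the shape in which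
  \<open>sum_multicount\<close> asks for the number of ends of an edge.\<close>

lemma card_edge:
  assumes "simple_graph G" "e \<in> edges G"
  shows "card {x \<in> UNIV. x \<in> e} = 2"
proof -
  obtain x y where "x \<noteq> y" "e = {x, y}"
    using assms unfolding simple_graph_def by blast
  then show ?thesis
    by (simp only: Collect_mem_eq UNIV_I simp_thms card_2_iff) blast
qed

lemma card_coxeter_edges: "card (edges \<Gamma>) = 42"
proof -
  \<comment> \<open>Counting incidences of vertices and edges in two ways gives 28 * 3 = 2 *
    42.\<close>
  have "(\<Sum>x\<in>UNIV. card {e \<in> edges \<Gamma>. x \<in> e}) = 2 * card (edges \<Gamma>)"
    by (rule sum_multicount[OF finite_coxeter_vertices finite_coxeter_edges])
      (rule ballI, rule card_edge[OF simple_coxeter])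
  then show ?thesis
    unfolding card_incident_edges by (simp add: card_coxeter_vertices)
qed

lemma finite_coxeter_copies: "finite (copies H \<Gamma>)"
proof (rule finite_subset)
  show "copies H \<Gamma> \<subseteq> (\<lambda>(A, E). \<lparr>verts = A, edges = E\<rparr>) ` (Pow UNIV \<times> Pow (edges \<Gamma>))"
  proof
    fix K assume "K \<in> copies H \<Gamma>"
    then have "edges K \<subseteq> edges \<Gamma>"
      by (simp add: copies_def subgraph_def)
    then show "K \<in> (\<lambda>(A, E). \<lparr>verts = A, edges = E\<rparr>) ` (Pow UNIV \<times> Pow (edges \<Gamma>))"
      by (intro image_eqI[of _ _ "(verts K, edges K)"]) simp_all
  qed
  show "finite ((\<lambda>(A, E). \<lparr>verts = A, edges = E\<rparr>) ` (Pow (UNIV :: coxeter_vertex set) \<times> Pow (edges \<Gamma>)))"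
    by (intro finite_imageI finite_cartesian_product finite_Pow_iff[THEN iffD2]
        finite_coxeter_vertices finite_coxeter_edges)
qed

lemma card_edges_heptagon:
  assumes "K \<in> copies (cycle_graph 7) \<Gamma>"
  shows "card (edges K) = 7"
proof -
  obtain c where c: "embedding c (cycle_graph 7) \<Gamma>" "K = map_graph c (cycle_graph 7)"
    using assms unfolding copies_eq[OF simple_cycle_7] by blast
  have "inj_on c (verts (cycle_graph 7))"
    using c(1) by (simp add: embedding_def)
  then have "inj_on ((`) c) (Pow (verts (cycle_graph 7)))"
    by (rule inj_on_image_Pow)
  then have "inj_on ((`) c) (edges (cycle_graph 7))"
    by (rule inj_on_subset) (use simple_graph_edge_subset[OF simple_cycle_7] in blast)
  then have "card (edges K) = card (edges (cycle_graph 7))"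
    unfolding c(2) edges_map_graph by (rule card_image)
  also have "\<dots> = 7"
    by (simp add: cycle_7 doubleton_eq_iff)
  finally show ?thesis .
qed

lemma card_heptagons_through_edge:
  assumes "e \<in> edges \<Gamma>"
  shows "card {K \<in> copies (cycle_graph 7) \<Gamma>. e \<in> edges K} = 4"
proof -
  obtain x y where e: "e = {x, y}"
    using assms simple_coxeter unfolding simple_graph_def by blast
  then have "y \<in> nbrs x"
    using assms edges_coxeter by simp
  from normalise_1_arc[OF this] obtain g where g: "automorphism g \<Gamma>" "g x = Z 0" "g y = U 0"
    by blast
  have bij: "bij g"
    using g(1) by (simp add: automorphism_coxeter_iff)
  let ?S = "\<lambda>e. {K \<in> copies (cycle_graph 7) \<Gamma>. e \<in> edges K}"
  have sub: "map_graph h K \<in> ?S (h ` f)" if "automorphism h \<Gamma>" "K \<in> ?S f" for h K f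
    using that map_graph_copies[OF simple_cycle_7] by simp
  have "bij_betw (map_graph g) (?S e) (?S {Z 0, U 0})"
  proof (rule bij_betw_byWitness[of _ "map_graph (inv g)"])
    have "map_graph g ` ?S e \<subseteq> ?S (g ` e)"
      by (rule image_subsetI) (rule sub[OF g(1)])
    then show "map_graph g ` ?S e \<subseteq> ?S {Z 0, U 0}"
      unfolding e by (simp only: image_insert image_empty g(2,3))
    have "inv g ` {Z 0, U 0} = e"
      unfolding e g(2,3)[symmetric] by (simp add: bij_is_inj[OF bij])
    moreover have "map_graph (inv g) ` ?S {Z 0, U 0} \<subseteq> ?S (inv g ` {Z 0, U 0})"
      by (rule image_subsetI) (rule sub[OF automorphism_inv[OF g(1)]])
    ultimately show "map_graph (inv g) ` ?S {Z 0, U 0} \<subseteq> ?S e"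
      by (simp only:)
  qed (simp_all only: map_graph_inv_cancel[OF bij] ball_triv simp_thms)
  then have "card (?S e) = card (?S {Z 0, U 0})"
    by (rule bij_betw_same_card)
  also have "\<dots> = 4"
    unfolding heptagons_through_edge using heptagons_distinct by simp
  finally show ?thesis .
qed

lemma card_heptagons: "card (copies (cycle_graph 7) \<Gamma>) = 24"
proof -
  \<comment> \<open>The double count ranges over edges of the whole graph; for a copy these include
    all edges of \<open>K\<close>.\<close>
  have "{e \<in> edges \<Gamma>. e \<in> edges K} = edges K" if "K \<in> copies (cycle_graph 7) \<Gamma>" for K
    using that unfolding copies_def subgraph_def by blast
  then have "(\<Sum>e\<in>edges \<Gamma>. card {K \<in> copies (cycle_graph 7) \<Gamma>. e \<in> edges K}) =
      7 * card (copies (cycle_graph 7) \<Gamma>)"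
    by (intro sum_multicount[OF finite_coxeter_edges finite_coxeter_copies] ballI)
      (simp only: card_edges_heptagon)
  moreover have "(\<Sum>e\<in>edges \<Gamma>. card {K \<in> copies (cycle_graph 7) \<Gamma>. e \<in> edges K}) = 42 * 4"
    by (simp add: card_heptagons_through_edge card_coxeter_edges)
  ultimately show ?thesis
    by simp
qed

section \<open>Girth\<close>

lemma girth_coxeter: "girth \<Gamma> = 7"
  unfolding girth_def
proof (rule Least_equality)
  have "heptagon hept1 \<in> copies (cycle_graph 7) \<Gamma>"
    using embedding_heptagons[OF insertI1] unfolding copies_eq[OF simple_cycle_7] heptagon_def by blast
  then show "3 \<le> (7::nat) \<and> copies (cycle_graph 7) \<Gamma> \<noteq> {}"
    by auto
next
  fix n :: nat assume n: "3 \<le> n \<and> copies (cycle_graph n) \<Gamma> \<noteq> {}"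
  show "7 \<le> n"
  proof (rule ccontr)
    assume "\<not> 7 \<le> n"
    with n have cases: "n = 3 \<or> n = 4 \<or> n = 5 \<or> n = 6"
      by auto
    have simple: "simple_graph (cycle_graph n)"
      using n by (intro simple_cycle_graph) simp
    from n obtain d where d: "embedding d (cycle_graph n) \<Gamma>"
      unfolding copies_eq[OF simple] by blast
    have "2 \<le> n"
      using n by simp
    note dn = embedding_cycle_coxeter[OF d this]
    have "d 1 \<in> nbrs (d 0)" "d 2 \<in> nbrs (d 1)" "d 2 \<noteq> d 0"
      using dn(1) dn(2)[of 0] dn(2)[of 1] n by (simp_all add: inj_on_eq_iff numeral_2_eq_2)
    \<comment> \<open>A 2-arc is the longest arc present in cycles of every length from 3 on. Once
      it is normalised, one walk from \<open>Z 0\<close>, \<open>U 0\<close>, \<open>U 1\<close>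
      treats all four lengths: its vertex at position \<open>n - 1\<close> would have to be a
      neighbour of \<open>Z 0\<close>.\<close>
    from normalise_2_arc[OF this] obtain g where
      g: "automorphism g \<Gamma>" "g (d 0) = Z 0" "g (d 1) = U 0" "g (d 2) = U 1"
      by blast
    define c where "c = g \<circ> d"
    have start: "c 0 = Z 0" "c 1 = U 0" "c 2 = U 1"
      using g by (simp_all add: c_def)
    have "embedding c (cycle_graph n) \<Gamma>"
      unfolding c_def by (rule embedding_automorphism[OF simple d g(1)])
    note c = embedding_cycle_coxeter[OF this \<open>2 \<le> n\<close>]
    note [simp del] = nbrs.simps
    note [simp] = nbrs_table nbrs.simps(4)
    have "c 0 \<in> nbrs (c (n - 1))"
      using c(2)[of "n - 1"] n by simp
    from nbrs_sym[OF this] have last: "c (n - 1) \<in> {U 0, V 0, T 0}"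
      unfolding start by simp
    \<comment> \<open>The bound keeps \<open>i + 2\<close> at most \<open>n - 1\<close>, so the
      index does not wrap around modulo \<open>n\<close>.\<close>
    have step: "c (i + 2) \<in> nbrs (c (i + 1))" "c (i + 2) \<noteq> c i" if "i + 3 \<le> n" for i
      using that c(2)[of "i + 1"] inj_onD[OF c(1), of "i + 2" i] by auto
    have c3: "c 3 \<in> {U 2, Z 1}" if "4 \<le> n"
      using step[of 1] that start by (simp add: eval_nat_numeral)
    have c4: "(c 3, c 4) \<in> {(U 2, U 3), (U 2, Z 2), (Z 1, V 1), (Z 1, T 1)}" if "5 \<le> n"
    proof -
      have "c 3 \<in> {U 2, Z 1}" "c 4 \<in> nbrs (c 3)" "c 4 \<noteq> c 2"
        using step[of 2] c3 that by simp_all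
      then show ?thesis
        using start by (elim insertE emptyE) simp_all
    qed
    have c5: "c 5 \<in> {U 4, Z 3, V 2, T 2, V 3, V 6, T 4, T 5}" if "6 \<le> n"
    proof -
      have "(c 3, c 4) \<in> {(U 2, U 3), (U 2, Z 2), (Z 1, V 1), (Z 1, T 1)}"
          "c 5 \<in> nbrs (c 4)" "c 5 \<noteq> c 3"
        using step[of 3] c4 that by simp_all
      then show ?thesis
        by (elim insertE emptyE; auto)
    qed
    show False
      using cases
    proof (elim disjE)
      assume "n = 3" then show False using last start by simp
    next
      assume "n = 4" then show False using last c3 by auto
    next
      assume "n = 5" then show False using last c4 by auto
    next
      assume "n = 6" then show False using last c5 by (elim insertE emptyE) simp_all
    qed
  qed
qed

section \<open>The sequence of paths from \<open>P_3\<close> to \<open>P_2\<close>\<close>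

lemma connected_path_graph:
  assumes "0 < n"
  shows "connected_graph (path_graph n)"
proof -
  let ?R = "{(a, b). {a, b} \<in> edges (path_graph n)}"
  have step: "(i, Suc i) \<in> ?R" "(Suc i, i) \<in> ?R" if "Suc i < n" for i
    using that by (auto simp: path_graph_def insert_commute)
  have up: "i < n \<Longrightarrow> (0, i) \<in> ?R\<^sup>*" for i
  proof (induction i)
    case (Suc i)
    then have "(0, i) \<in> ?R\<^sup>*"
      by simp
    then show ?case
      by (rule rtrancl.rtrancl_into_rtrancl) (rule step(1)[OF Suc.prems])
  qed simp
  have down: "i < n \<Longrightarrow> (i, 0) \<in> ?R\<^sup>*" for i
  proof (induction i)
    case (Suc i)
    then have "(i, 0) \<in> ?R\<^sup>*"
      by simp
    then show ?case
      by (rule converse_rtrancl_into_rtrancl[rotated]) (rule step(2)[OF Suc.prems])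
  qed simp
  have verts: "verts (path_graph n) = {..<n}"
    by (simp add: path_graph_def)
  show ?thesis
    unfolding connected_graph_def verts
  proof (intro conjI ballI)
    show "{..<n} \<noteq> {}"
      using assms by auto
    show "(x, y) \<in> ?R\<^sup>*" if "x \<in> {..<n}" "y \<in> {..<n}" for x y
      using rtrancl_trans[OF down up] that by simp
  qed
qed

lemma isomorphic_path_2: "isomorphic (path_graph 2) (complete_graph 2)"
proof -
  have "complete_graph 2 = path_graph 2"
    unfolding path_2 complete_graph_def by (auto simp: less_2_cases_iff)
  moreover have "isomorphism id (path_graph 2) (path_graph 2)"
    by (simp add: isomorphism_def)
  ultimately show ?thesis
    unfolding isomorphic_def by metis
qed

lemma strongly_fastened_coxeter:
  "strongly_fastened_UH_wrt [path_graph 3, path_graph 2] (cycle_graph 7) \<Gamma>"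
  unfolding strongly_fastened_UH_wrt_def
proof (intro conjI allI impI)
  show "isomorphic (last [path_graph 3, path_graph 2]) (complete_graph 2)"
    by (simp add: isomorphic_path_2)
next
  fix i assume "i < length [path_graph 3, path_graph 2]"
  then have "i = 0 \<or> i = 1"
    by auto
  moreover have "subgraph (path_graph 3) (cycle_graph 7)" "subgraph (path_graph 2) (cycle_graph 7)"
    using fastened_UH_P3 fastened_UH_P2 by (simp_all only: fastened_UH_def)
  ultimately show "connected_graph ([path_graph 3, path_graph 2] ! i)"
      "subgraph ([path_graph 3, path_graph 2] ! i) (cycle_graph 7)"
      "fastened_UH (2 ^ (i + 1) - 1) (cycle_graph 7) ([path_graph 3, path_graph 2] ! i) \<Gamma>"
    using connected_path_graph[of 3] connected_path_graph[of 2] fastened_UH_P3 fastened_UH_P2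
    by (elim disjE; simp)+
next
  fix i assume "i + 1 < length [path_graph 3, path_graph 2]"
  then have "i = 0"
    by simp
  \<comment> \<open>Deleting the last vertex, rather than vertex 0, gives
    \<open>path_graph 2\<close> literally and not just up to isomorphism.\<close>
  moreover have "path_graph 2 = delete_vertex (path_graph 3) 2"
    unfolding path_2 path_3 delete_vertex_def by auto
  moreover have "2 \<in> verts (path_graph 3)"
    by (simp add: path_3)
  ultimately show "\<exists>v\<in>verts ([path_graph 3, path_graph 2] ! i).
      [path_graph 3, path_graph 2] ! (i + 1) = delete_vertex ([path_graph 3, path_graph 2] ! i) v"
    by auto
qed simp

theorem theorem1:
  "strongly_fastened_UH_wrt [path_graph 3, path_graph 2] (cycle_graph 7) coxeter_graph
   \<and> strongly_fastened_UH (cycle_graph 7) (path_graph 3) coxeter_graph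
   \<and> fastened_UH 1 (cycle_graph 7) (path_graph 3) coxeter_graph
   \<and> fastened_UH 3 (cycle_graph 7) (path_graph 2) coxeter_graph
   \<and> tightly_fastened_UH (cycle_graph 7) (path_graph 3) coxeter_graph
   \<and> card (verts coxeter_graph) = 28
   \<and> girth coxeter_graph = 7
   \<and> card (copies (cycle_graph (girth coxeter_graph)) coxeter_graph) = 24
   \<and> 6 * real (card (verts coxeter_graph)) / real (girth coxeter_graph) = 24"
proof -
  have "strongly_fastened_UH (cycle_graph 7) (path_graph 3) \<Gamma>"
    unfolding strongly_fastened_UH_def
    by (intro exI[of _ "[path_graph 3, path_graph 2]"] conjI strongly_fastened_coxeter) simp_all
  then show ?thesis
    using strongly_fastened_coxeter fastened_UH_P3 fastened_UH_P2
    by (simp add: tightly_fastened_UH_def girth_coxeter card_heptagons card_coxeter_vertices)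
qed

end
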